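(* Let $f\colon\mathbb{N}\to\mathbb{N}$ be a subexponential function (arbitrarily rapid) and let $\omega\colon \mathbb{N}\to \mathbb{N}$ be a non-decreasing, super-polynomial function (arbitrarily slow). Let $F$ be an uncountable field with $\operatorname{char}(F)\neq 2$. Then there exists a finitely generated nil Lie algebra $L$ over $F$, with growth function $g_L$ (with respect to a suitable finite-dimensional generating subspace), such that: (1) $g_L(n)\leq \omega(n)$ for infinitely many $n$; and (2) $g_L(n)\geq f(n)$ for infinitely many $n$.
   Context: $\mathbb{N}=\{1,2,\dots\}$. A non-decreasing function $f\colon\mathbb{N}\to\mathbb{N}$ is subexponential if $\limsup_{n\to\infty}\sqrt[n]{f(n)}=1$. A function $\omega$ is super-polynomial if $\omega(n)/n^d\to\infty$ as $n\to\infty$ for every $d>0$. A Lie algebra $L$ is nil if $\operatorname{ad}_x$ is nilpotent for every $x\in L$. If a Lie algebra $L$ over $F$ is generated by a finite-dimensional subspace $V$, its growth function with respect to $V$ is $g_L(n)=\dim_F(V+V^{[2]}+\cdots+V^{[n]})$, where $V^{[i]}$ is the span of the Lie monomials of length $i$ in elements of $V$; i.e. $g_L(n)$ is the dimension of the span of all Lie monomials of length at most $n$ in elements of $V$. *)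

theory Defs
  imports "HOL-Analysis.Analysis" "HOL-Library.Poly_Mapping" "HOL-Library.Set_Algebras"
begin

text \<open>
  Functions on the positive integers are functions on \<^typ>\<open>nat\<close> whose value at 0 is never
  constrained; being a map into the positive integers is written \<^term>\<open>f \<in> {1..} \<rightarrow> {1..}\<close>.
\<close>

definition subexponential :: "(nat \<Rightarrow> nat) \<Rightarrow> bool" where
  "subexponential f \<longleftrightarrow>
     f \<in> {1..} \<rightarrow> {1..} \<and> mono_on {1..} f \<and>
     limsup (\<lambda>n. ereal (root n (real (f n)))) = 1"

definition super_polynomial :: "(nat \<Rightarrow> nat) \<Rightarrow> bool" where
  "super_polynomial \<omega> \<longleftrightarrow>
     (\<forall>d::real. d > 0 \<longrightarrow> filterlim (\<lambda>n. real (\<omega> n) / real n powr d) at_top sequentially)"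

text \<open>
  A Lie algebra is a subspace \<open>L\<close> of an ambient vector space with a bracket on \<open>L\<close>;
  the bracket is irrelevant outside \<open>L\<close>. A finitely generated Lie algebra over a field \<open>'k\<close> has
  countable dimension, so for these one loses nothing by taking the ambient vector space to be
  \<^typ>\<open>nat \<Rightarrow>\<^sub>0 'k::zero\<close>.
\<close>

locale lie_algebra = vector_space scale
  for scale :: "'k::field \<Rightarrow> 'v::ab_group_add \<Rightarrow> 'v" +
  fixes L :: "'v set"
    and bracket :: "'v \<Rightarrow> 'v \<Rightarrow> 'v"
  assumes subspace_carrier: "subspace L"
    and bracket_closed: "x \<in> L \<Longrightarrow> y \<in> L \<Longrightarrow> bracket x y \<in> L"
    and bracket_add_left:
      "x \<in> L \<Longrightarrow> y \<in> L \<Longrightarrow> z \<in> L \<Longrightarrow> bracket (x + y) z = bracket x z + bracket y z"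
    and bracket_add_right:
      "x \<in> L \<Longrightarrow> y \<in> L \<Longrightarrow> z \<in> L \<Longrightarrow> bracket x (y + z) = bracket x y + bracket x z"
    and bracket_scale_left:
      "x \<in> L \<Longrightarrow> y \<in> L \<Longrightarrow> bracket (scale c x) y = scale c (bracket x y)"
    and bracket_scale_right:
      "x \<in> L \<Longrightarrow> y \<in> L \<Longrightarrow> bracket x (scale c y) = scale c (bracket x y)"
    and bracket_self: "x \<in> L \<Longrightarrow> bracket x x = 0"
    and jacobi:
      "x \<in> L \<Longrightarrow> y \<in> L \<Longrightarrow> z \<in> L \<Longrightarrow>
        bracket x (bracket y z) + bracket y (bracket z x) + bracket z (bracket x y) = 0"
begin

definition ad :: "'v \<Rightarrow> 'v \<Rightarrow> 'v" where
  "ad x = (\<lambda>y. bracket x y)"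

definition nil :: bool where
  "nil \<longleftrightarrow> (\<forall>x\<in>L. \<exists>m. \<forall>y\<in>L. (ad x ^^ m) y = 0)"

definition lie_subalgebra :: "'v set \<Rightarrow> bool" where
  "lie_subalgebra S \<longleftrightarrow> subspace S \<and> S \<subseteq> L \<and> (\<forall>x\<in>S. \<forall>y\<in>S. bracket x y \<in> S)"

definition generates :: "'v set \<Rightarrow> bool" where
  "generates X \<longleftrightarrow> X \<subseteq> L \<and> lie_subalgebra hull X = L"

definition finitely_generated :: bool where
  "finitely_generated \<longleftrightarrow> (\<exists>X. finite X \<and> generates X)"

definition fin_dim_generating_subspace :: "'v set \<Rightarrow> bool" where
  "fin_dim_generating_subspace V \<longleftrightarrow>
     subspace V \<and> (\<exists>B. finite B \<and> span B = V) \<and> generates V"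

inductive lie_monomial :: "'v set \<Rightarrow> nat \<Rightarrow> 'v \<Rightarrow> bool" for V where
  letter: "v \<in> V \<Longrightarrow> lie_monomial V 1 v"
| bracket: "lie_monomial V i x \<Longrightarrow> lie_monomial V j y \<Longrightarrow> lie_monomial V (i + j) (bracket x y)"

definition lie_power :: "'v set \<Rightarrow> nat \<Rightarrow> 'v set" where
  "lie_power V i = span {x. lie_monomial V i x}"

text \<open>The sum below is the sum of subspaces, i.e. the elementwise sum of sets.
  The library's \<open>dim\<close> is the true dimension here for finite-dimensional \<open>V\<close> (it is 0 on
  infinite-dimensional spaces).\<close>

definition growth :: "'v set \<Rightarrow> nat \<Rightarrow> nat" where
  "growth V n = dim (\<Sum>i = 1..n. lie_power V i)"

end

end

theory Submission
  imports Defs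
begin

text \<open>
  Let \<open>T\<close> be the free algebra on two letters and \<open>E\<close> an ideal such that \<open>A = T\<^sub>+/E\<close> is nil. The Lie
  algebra generated by the letters and the unit of the module inside the semidirect product of
  \<open>A\<close> (with the commutator bracket) and the abelian ideal \<open>T/E\<close> (the left regular module) is then
  nil. The words acting on the unit reach all of \<open>T/E\<close>, so the growth of the Lie algebra is, up to
  a factor \<open>2\<close> and a shift by \<open>1\<close>, that of \<open>A\<close>, and it suffices to make the growth of a nil algebra
  \<open>A\<close> oscillate.

  The ideal \<open>E\<close> is the annihilator of a family of functionals on words, built in levels. A level has
  two functionals \<open>g 0\<close>, \<open>g 1\<close> on words of length \<open>N\<close>. All \<open>2 ^ e\<close> products of \<open>e\<close> of them belong
  to the family; since \<open>f\<close> is subexponential this makes the growth at \<open>N e\<close> larger than \<open>f\<close> when \<open>e\<close>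
  is large. To pass to the next level, take \<open>M = N e t\<close> with \<open>t\<close> huge. For a word with blocks
  \<open>w\<^sub>1, w\<^sub>2, \<dots>\<close> of length \<open>N\<close> the polynomial \<open>\<Prod> (g 0 w\<^sub>l + g 1 w\<^sub>l z\<^bsup>x\<^sub>l\<^esup>)\<close>, where every power
  \<open>(t + 1)\<^sup>i\<close> with \<open>i < e\<close> is \<open>t\<close> times an exponent \<open>x\<^sub>l\<close>, takes all the values
  \<open>1, z, \<dots>, z ^ ((t + 1) ^ e - 1)\<close>, by writing the exponent in base \<open>t + 1\<close>. The new functionals
  are linear combinations of its coefficients which vanish on the powers of the generic element of
  bounded degree: this imposes a number of conditions which is polynomial in \<open>t\<close> of a degree less
  than \<open>e\<close>, so a two-dimensional space of combinations survives, and nilpotency is inherited by all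
  later levels. As the coefficients of a subword span a space of dimension polynomial in \<open>t\<close>, the
  growth at \<open>M\<close> is polynomial in \<open>t\<close>, hence at most \<open>\<omega> M\<close>.
\<close>

section \<open>Functionals on the free algebra\<close>

text \<open>With concatenation as addition of exponents, the convolution product turns
  \<open>bool list \<Rightarrow>\<^sub>0 'k\<close> into the free associative algebra on two
  letters.\<close>

instantiation list :: (type) monoid_add
begin
definition zero_list :: "'a list" where "0 = []"
definition plus_list :: "'a list \<Rightarrow> 'a list \<Rightarrow> 'a list" where "xs + ys = xs @ ys"
instance by standard (auto simp: zero_list_def plus_list_def)
end

abbreviation lookup where "lookup \<equiv> Poly_Mapping.lookup"
abbreviation keys where "keys \<equiv> Poly_Mapping.keys"
abbreviation single where "single \<equiv> Poly_Mapping.single"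

text \<open>Stated for any exponent monoid, so that one scalar action serves both the free algebra
  and the ambient space of the Lie algebra, whose exponents are natural numbers.\<close>

definition smul :: "'k::field \<Rightarrow> ('w::monoid_add \<Rightarrow>\<^sub>0 'k) \<Rightarrow> ('w \<Rightarrow>\<^sub>0 'k)" where
  "smul c p = single 0 c * p"

lemma lookup_smul [simp]: "lookup (smul c p) w = c * lookup p w"
  unfolding smul_def mult_map_scale_conv_mult[symmetric]
  by (simp add: Poly_Mapping.map.rep_eq when_def)

lemma vector_space_smul: "vector_space smul"
  by standard (auto intro!: poly_mapping_eqI simp: lookup_add algebra_simps)

lemma smul_smul [simp]: "smul c (smul d p) = smul (c * d) p"
  by (rule poly_mapping_eqI) (simp add: mult.assoc)

lemma smul_mult_left: "smul c a * b = smul c (a * b)"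
  by (simp add: smul_def mult.assoc)

text \<open>Constants are central although concatenation does not commute: \<open>0\<close> is the
  empty word, so multiplying by \<open>single 0 c\<close> on either side only scales
  coefficients.\<close>

lemma smul_mult_right: "a * smul c b = smul c (a * b)"
proof -
  have "lookup (a * single 0 c) w = lookup (single 0 c * a) w" for w
  proof -
    have eq: "(\<Sum>q. (c when 0 = q) when w = l + q) = (c when w = l)" for l
    proof -
      have "(\<Sum>q. (c when 0 = q) when w = l + q) = (\<Sum>q. (c when w = l + q) when 0 = q)"
        by (rule Sum_any.cong) (auto simp: when_def)
      then show ?thesis by simp
    qed
    have "lookup (a * single 0 c) w = (\<Sum>l. lookup a l * (c when w = l))"
      unfolding times_poly_mapping.rep_eq prod_fun_def lookup_single eq ..
    also have "\<dots> = c * lookup a w"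
      by (simp add: mult_when mult.commute)
    finally have "lookup (a * single 0 c) w = c * lookup a w" .
    then show ?thesis using lookup_smul[of c a w] by (simp add: smul_def)
  qed
  then have "a * single 0 c = single 0 c * a" by (rule poly_mapping_eqI)
  then show ?thesis by (simp add: smul_def mult.assoc[symmetric])
qed

lemma smul_single: "smul c (single w d) = single w (c * d)"
  by (simp add: smul_def mult_single)

lemma poly_mapping_eq_sum_single: "p = (\<Sum>w\<in>keys p. single w (lookup p w))"
proof (rule poly_mapping_eqI)
  fix v
  show "lookup p v = lookup (\<Sum>w\<in>keys p. single w (lookup p w)) v"
    by (cases "v \<in> keys p") (auto simp: lookup_sum lookup_single when_def in_keys_iff)
qed

section \<open>Evaluation of functionals\<close>

text \<open>An arbitrary function on the basis is a linear functional on finitely supported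
  elements, so \<open>h\<close> ranges over the full dual space.\<close>

definition pairing :: "('w \<Rightarrow> 'k::field) \<Rightarrow> ('w \<Rightarrow>\<^sub>0 'k) \<Rightarrow> 'k" where
  "pairing h r = (\<Sum>w\<in>keys r. lookup r w * h w)"

lemma pairing_eq_sum:
  assumes "finite A" "keys r \<subseteq> A"
  shows "pairing h r = (\<Sum>w\<in>A. lookup r w * h w)"
  unfolding pairing_def using assms by (intro sum.mono_neutral_left) (auto simp: in_keys_iff)

lemma pairing_zero [simp]: "pairing h 0 = 0"
  by (simp add: pairing_def)

lemma pairing_add: "pairing h (r + s) = pairing h r + pairing h s"
proof -
  let ?A = "keys r \<union> keys s"
  have "keys (r + s) \<subseteq> ?A" by (rule Poly_Mapping.keys_add)
  then show ?thesis
    by (simp add: pairing_eq_sum[of ?A] lookup_add algebra_simps sum.distrib)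
qed

lemma pairing_sum: "pairing h (sum f A) = (\<Sum>x\<in>A. pairing h (f x))"
  by (induction A rule: infinite_finite_induct) (auto simp: pairing_add)

lemma pairing_smul: "pairing h (smul c r) = c * pairing h r"
proof -
  have "keys (smul c r) \<subseteq> keys r" by (auto simp: in_keys_iff)
  then show ?thesis
    by (simp add: pairing_eq_sum[of "keys r"] sum_distrib_left algebra_simps)
qed

lemma pairing_uminus: "pairing h (- r) = - pairing h r"
  using pairing_add[of h r "-r"] by (simp add: add_eq_0_iff)

lemma pairing_diff: "pairing h (r - s) = pairing h r - pairing h s"
  using pairing_add[of h r "-s"] by (simp add: pairing_uminus)

lemma pairing_single [simp]: "pairing h (single w c) = c * h w"
  by (cases "c = 0") (auto simp: pairing_def)

lemma pairing_cong: "(\<And>w. w \<in> keys r \<Longrightarrow> h w = h' w) \<Longrightarrow> pairing h r = pairing h' r"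
  unfolding pairing_def by (auto intro: sum.cong)

lemma pairing_eq_0: "(\<And>w. w \<in> keys r \<Longrightarrow> h w = 0) \<Longrightarrow> pairing h r = 0"
  unfolding pairing_def by (auto intro: sum.neutral)

lemma pairing_fun_zero [simp]: "pairing (\<lambda>w. 0) r = 0"
  by (simp add: pairing_def)

lemma pairing_fun_add: "pairing (\<lambda>w. h w + h' w) r = pairing h r + pairing h' r"
  by (simp add: pairing_def algebra_simps sum.distrib)

lemma pairing_fun_mult: "pairing (\<lambda>w. c * h w) r = c * pairing h r"
  by (simp add: pairing_def sum_distrib_left mult.left_commute)

lemma pairing_fun_mult_right: "pairing (\<lambda>w. h w * c) r = pairing h r * c"
  by (simp add: pairing_def sum_distrib_right mult.assoc)

lemma pairing_fun_sum: "pairing (\<lambda>w. \<Sum>i\<in>I. h i w) r = (\<Sum>i\<in>I. pairing (h i) r)"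
  by (induction I rule: infinite_finite_induct) (auto simp: pairing_fun_add)

lemma pairing_swap:
  "pairing (\<lambda>w. pairing (\<lambda>z. H w z) b) a = pairing (\<lambda>z. pairing (\<lambda>w. H w z) a) b"
  unfolding pairing_def sum_distrib_left
  by (subst sum.swap) (simp add: mult.left_commute)

lemma pairing_mult:
  fixes a b :: "'w::monoid_add \<Rightarrow>\<^sub>0 'k::field"
  shows "pairing h (a * b) = pairing (\<lambda>w. pairing (\<lambda>z. h (w + z)) b) a"
proof -
  have "a * b = (\<Sum>w\<in>keys a. \<Sum>z\<in>keys b. single (w + z) (lookup a w * lookup b z))"
    by (subst poly_mapping_eq_sum_single[of a], subst poly_mapping_eq_sum_single[of b])
       (simp add: sum_product mult_single)
  then show ?thesis
    by (simp add: pairing_sum) (simp add: pairing_def sum_distrib_left mult.assoc)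
qed

lemma pairing_mult_list:
  fixes a b :: "'w list \<Rightarrow>\<^sub>0 'k::field"
  shows "pairing h (a * b) = pairing (\<lambda>w. pairing (\<lambda>z. h (w @ z)) b) a"
  by (simp add: pairing_mult plus_list_def)

lemma keys_mult_list:
  fixes a b :: "'w list \<Rightarrow>\<^sub>0 'k::field"
  assumes "w \<in> keys (a * b)"
  obtains x y where "x \<in> keys a" "y \<in> keys b" "w = x @ y"
  using keys_mult[of a b] assms by (auto simp: plus_list_def)

lemma length_keys_power:
  fixes a :: "'w list \<Rightarrow>\<^sub>0 'k::field"
  assumes "\<And>w. w \<in> keys a \<Longrightarrow> 1 \<le> length w" and "w \<in> keys (a ^ s)"
  shows "s \<le> length w"
  using assms(2)
proof (induction s arbitrary: w)
  case (Suc s)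
  from Suc.prems obtain x y where "x \<in> keys a" "y \<in> keys (a ^ s)" "w = x @ y"
    by (auto elim: keys_mult_list)
  with Suc.IH[of y] assms(1)[of x] show ?case by simp
qed auto

section \<open>Linear spans of functionals and elimination\<close>

inductive_set lspan :: "('w \<Rightarrow> 'k::field) set \<Rightarrow> ('w \<Rightarrow> 'k) set" for S where
  lspan_zero: "(\<lambda>w. 0) \<in> lspan S"
| lspan_step: "f \<in> S \<Longrightarrow> h \<in> lspan S \<Longrightarrow> (\<lambda>w. c * f w + h w) \<in> lspan S"

lemma lspan_base: "f \<in> S \<Longrightarrow> f \<in> lspan S"
  using lspan_step[OF _ lspan_zero, of f S 1] by simp

lemma lspan_add: "f \<in> lspan S \<Longrightarrow> h \<in> lspan S \<Longrightarrow> (\<lambda>w. f w + h w) \<in> lspan S"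
proof (induction rule: lspan.induct)
  case (lspan_step f h' c)
  then show ?case using lspan.lspan_step[of f S "\<lambda>w. h' w + h w" c] by (simp add: add.assoc)
qed simp

lemma lspan_scale: "f \<in> lspan S \<Longrightarrow> (\<lambda>w. c * f w) \<in> lspan S"
proof (induction rule: lspan.induct)
  case lspan_zero
  then show ?case by (simp add: lspan.lspan_zero)
next
  case (lspan_step f h' d)
  then show ?case using lspan.lspan_step[of f S "\<lambda>w. c * h' w" "c * d"] by (simp add: algebra_simps)
qed

lemma lspan_lincomb:
  "f \<in> lspan S \<Longrightarrow> h \<in> lspan S \<Longrightarrow> (\<lambda>w. c * f w + h w) \<in> lspan S"
  by (rule lspan_add[OF lspan_scale])

lemma lspan_sum: "(\<And>i. i \<in> I \<Longrightarrow> f i \<in> lspan S) \<Longrightarrow> (\<lambda>w. \<Sum>i\<in>I. f i w) \<in> lspan S"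
  by (induction I rule: infinite_finite_induct) (auto intro: lspan_zero lspan_add)

lemma pairing_lspan_eq_0:
  assumes "f \<in> lspan S" and "\<And>s. s \<in> S \<Longrightarrow> pairing s r = 0"
  shows "pairing f r = 0"
  using assms(1)
  by induction (use assms(2) in \<open>auto simp: pairing_fun_add pairing_fun_mult\<close>)

lemma lspan_compose:
  assumes "f \<in> lspan S" and "\<And>s. s \<in> S \<Longrightarrow> (\<lambda>w. s (\<phi> w)) \<in> lspan S'"
  shows "(\<lambda>w. f (\<phi> w)) \<in> lspan S'"
  using assms(1)
proof induction
  case lspan_zero
  show ?case by (rule lspan.lspan_zero)
next
  case (lspan_step f h c)
  from lspan_lincomb[OF assms(2)[OF lspan_step(1)] lspan_step(3)] show ?case .
qed

lemma lspan_product: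
  assumes "f \<in> lspan S" and "h \<in> lspan S'"
    and "\<And>s s'. s \<in> S \<Longrightarrow> s' \<in> S' \<Longrightarrow> (\<lambda>w. s (\<phi> w) * s' (\<psi> w)) \<in> lspan U"
  shows "(\<lambda>w. f (\<phi> w) * h (\<psi> w)) \<in> lspan U"
proof -
  have *: "(\<lambda>w. s (\<phi> w) * h (\<psi> w)) \<in> lspan U" if "s \<in> S" for s
    using assms(2)
  proof induction
    case lspan_zero
    then show ?case by (simp add: lspan.lspan_zero)
  next
    case (lspan_step f h c)
    from lspan_add[OF lspan_scale[OF assms(3)[OF that lspan_step(1)], of c] lspan_step(3)]
    show ?case by (simp add: algebra_simps)
  qed
  from assms(1) show ?thesis
  proof induction
    case lspan_zero
    then show ?case by (simp add: lspan.lspan_zero)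
  next
    case (lspan_step f h' c)
    from lspan_add[OF lspan_scale[OF *[OF lspan_step(1)], of c] lspan_step(3)]
    show ?case by (simp add: algebra_simps)
  qed
qed

text \<open>Gaussian elimination: each linear condition in \<open>R\<close> costs at most one pivot
  in \<open>I\<close>. The solutions attached to the remaining indices are unit vectors off
  \<open>I\<close>, so they are independent and come with explicit dual coordinates.\<close>

lemma elimination:
  fixes R :: "('i \<Rightarrow> 'k::field) set"
  assumes "finite R" and "finite J"
  shows "\<exists>I cf. I \<subseteq> J \<and> card I \<le> card R \<and>
    (\<forall>j\<in>J - I. (\<forall>i\<in>J - I. cf j i = (if i = j then 1 else 0)) \<and>
       (\<forall>\<rho>\<in>R. (\<Sum>i\<in>J. cf j i * \<rho> i) = 0))"
  using assms(1)
proof induction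
  case empty
  show ?case by (rule exI[of _ "{}"], rule exI[of _ "\<lambda>j i. if i = j then 1 else 0"]) simp
next
  case (insert \<rho> R)
  then obtain I and cf :: "'i \<Rightarrow> 'i \<Rightarrow> 'k" where I: "I \<subseteq> J" "card I \<le> card R"
    and L: "\<And>i j. j \<in> J - I \<Longrightarrow> i \<in> J - I \<Longrightarrow> cf j i = (if i = j then 1 else 0)"
    and K: "\<And>j \<rho>. j \<in> J - I \<Longrightarrow> \<rho> \<in> R \<Longrightarrow> (\<Sum>i\<in>J. cf j i * \<rho> i) = 0"
    by blast
  define v where "v j = (\<Sum>i\<in>J. cf j i * \<rho> i)" for j
  show ?case
  proof (cases "\<forall>j\<in>J - I. v j = 0")
    case True
    then show ?thesis using I L K insert
      by (intro exI[of _ I] exI[of _ cf]) (auto simp: v_def)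
  next
    case False
    then obtain j0 where j0: "j0 \<in> J - I" "v j0 \<noteq> 0" by blast
    \<comment> \<open>The index \<open>j0\<close> becomes a pivot: a multiple of its row is
      subtracted from the others to meet the new condition.\<close>
    define \<mu> where "\<mu> j i = cf j i - v j / v j0 * cf j0 i" for j i
    have sum_\<mu>: "(\<Sum>i\<in>J. \<mu> j i * \<sigma> i) = (\<Sum>i\<in>J. cf j i * \<sigma> i) - v j / v j0 * (\<Sum>i\<in>J. cf j0 i * \<sigma> i)"
      for j \<sigma> by (simp add: \<mu>_def algebra_simps sum_subtractf sum_distrib_left)
    have "card (insert j0 I) \<le> card (insert \<rho> R)"
      using I insert j0 finite_subset[OF I(1) assms(2)] by simp
    moreover have "\<mu> j i = (if i = j then 1 else 0)"
      if "j \<in> J - insert j0 I" "i \<in> J - insert j0 I" for i j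
      using that j0 L[of j i] L[of j0 i] by (auto simp: \<mu>_def)
    moreover have "(\<Sum>i\<in>J. \<mu> j i * \<sigma> i) = 0" if "j \<in> J - insert j0 I" "\<sigma> \<in> insert \<rho> R" for j \<sigma>
      using that j0 K[of j \<sigma>] K[of j0 \<sigma>] unfolding sum_\<mu> by (auto simp: v_def[symmetric])
    ultimately show ?thesis using I j0
      by (intro exI[of _ "insert j0 I"] exI[of _ \<mu>]) auto
  qed
qed

section \<open>Levels\<close>

text \<open>The tensor product of the functionals \<open>g b\<close> along consecutive blocks; the
  base case forces the word to end with its last block.\<close>

primrec block_prod :: "nat \<Rightarrow> (bool \<Rightarrow> bool list \<Rightarrow> 'k::field) \<Rightarrow> bool list \<Rightarrow> bool list \<Rightarrow> 'k" where
  "block_prod N g [] w = (if w = [] then 1 else 0)"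
| "block_prod N g (b # \<beta>) w = g b (take N w) * block_prod N g \<beta> (drop N w)"

text \<open>The coefficient of \<open>z ^ j\<close> in the product over the blocks \<open>w\<^sub>l\<close> of \<open>w\<close> of
  \<open>g False w\<^sub>l + g True w\<^sub>l * z ^ x\<^sub>l\<close>.\<close>

primrec block_coeff :: "nat \<Rightarrow> (bool \<Rightarrow> bool list \<Rightarrow> 'k::field) \<Rightarrow> nat list \<Rightarrow> nat \<Rightarrow> bool list \<Rightarrow> 'k" where
  "block_coeff N g [] j w = (if w = [] \<and> j = 0 then 1 else 0)"
| "block_coeff N g (x # ex) j w = g False (take N w) * block_coeff N g ex j (drop N w) +
     (if x \<le> j then g True (take N w) * block_coeff N g ex (j - x) (drop N w) else 0)"

text \<open>The exponent of \<open>z\<close> collected when the blocks marked \<open>True\<close>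
  contribute their second term. Using \<open>hd\<close> and \<open>tl\<close> keeps the recursion on
  the boolean list alone.\<close>

primrec dot :: "bool list \<Rightarrow> nat list \<Rightarrow> nat" where
  "dot [] ex = 0"
| "dot (b # \<beta>) ex = (if b then hd ex else 0) + dot \<beta> (tl ex)"

text \<open>Surrounding words \<open>u\<close> and \<open>v\<close> make this a two-sided ideal
  condition. The number of blocks is unrestricted, which is what lets the condition pass to later
  levels.\<close>

definition annihilates :: "nat \<Rightarrow> (bool \<Rightarrow> bool list \<Rightarrow> 'k::field) \<Rightarrow> (bool list \<Rightarrow>\<^sub>0 'k) \<Rightarrow> bool" where
  "annihilates N g r \<longleftrightarrow> (\<forall>\<beta> u v. pairing (\<lambda>w. block_prod N g \<beta> (u @ w @ v)) r = 0)"

lemma pairing_take_drop: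
  fixes a b :: "'w list \<Rightarrow>\<^sub>0 'k::field"
  assumes "\<And>w. w \<in> keys a \<Longrightarrow> length w = n"
  shows "pairing (\<lambda>w. f (take n w) * h (drop n w)) (a * b) = pairing f a * pairing h b"
proof -
  have "pairing (\<lambda>w. f (take n w) * h (drop n w)) (a * b) = pairing (\<lambda>w. f w * pairing h b) a"
    unfolding pairing_mult_list
    by (rule pairing_cong) (simp add: assms pairing_fun_mult)
  then show ?thesis by (simp add: pairing_fun_mult_right)
qed

text \<open>The elements \<open>r b\<close> witness that the two functionals are independent;
  multiplying them yields dual families for all products of blocks.\<close>

locale level =
  fixes N :: nat and g :: "bool \<Rightarrow> bool list \<Rightarrow> 'k::field" and r :: "bool \<Rightarrow> (bool list \<Rightarrow>\<^sub>0 'k)"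
  assumes N_pos: "N > 0"
    and g_length: "g b w \<noteq> 0 \<Longrightarrow> length w = N"
    and r_length: "w \<in> keys (r b) \<Longrightarrow> length w = N"
    and dual: "pairing (g b) (r b') = (if b = b' then 1 else 0)"
begin

lemma block_prod_length: "block_prod N g \<beta> w \<noteq> 0 \<Longrightarrow> length w = N * length \<beta>"
proof (induction \<beta> arbitrary: w)
  case (Cons b \<beta>)
  then have "length (take N w) = N" "length (drop N w) = N * length \<beta>"
    using g_length[of b "take N w"] Cons.IH[of "drop N w"] by (fastforce, fastforce)
  then show ?case by simp
qed (simp split: if_splits)

lemma block_prod_append_left:
  "length x = N * length \<beta> \<Longrightarrow> block_prod N g (\<beta> @ \<beta>') (x @ y) = block_prod N g \<beta> x * block_prod N g \<beta>' y"
  by (induction \<beta> arbitrary: x) auto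

lemma block_prod_append_right:
  assumes "length y = N * length \<beta>'"
  shows "block_prod N g (\<beta> @ \<beta>') (x @ y) = block_prod N g \<beta> x * block_prod N g \<beta>' y"
proof (cases "length x = N * length \<beta>")
  case False
  then have "block_prod N g \<beta> x = 0" "block_prod N g (\<beta> @ \<beta>') (x @ y) = 0"
    using block_prod_length[of \<beta> x] block_prod_length[of "\<beta> @ \<beta>'" "x @ y"] assms by (auto simp: algebra_simps)
  then show ?thesis by simp
qed (rule block_prod_append_left)

lemma block_coeff_length: "block_coeff N g ex j w \<noteq> 0 \<Longrightarrow> length w = N * length ex"
proof (induction ex arbitrary: w j)
  case (Cons x ex)
  have "\<exists>b. g b (take N w) \<noteq> 0 \<and> (\<exists>j. block_coeff N g ex j (drop N w) \<noteq> 0)"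
  proof (rule ccontr)
    assume "\<not> ?thesis"
    then have "g b (take N w) * block_coeff N g ex j (drop N w) = 0" for b j by auto
    with Cons.prems show False by (simp del: mult_eq_0_iff split: if_splits)
  qed
  then have "length (take N w) = N" "length (drop N w) = N * length ex"
    using g_length Cons.IH by blast+
  then show ?case by simp
qed (simp split: if_splits)

text \<open>The recursion peels off the first block; this peels off the last one, as is needed for
  contexts to the right of a word.\<close>

lemma block_coeff_snoc:
  assumes "length z = N"
  shows "block_coeff N g (ex @ [x]) j (y @ z) = block_coeff N g ex j y * g False z +
    (if x \<le> j then block_coeff N g ex (j - x) y * g True z else 0)"
proof (cases "length y = N * length ex")
  case True
  then show ?thesis
  proof (induction ex arbitrary: y j)
    case Nil
    with assms show ?case by simp
  next
    case (Cons x' ex)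
    then have "take N (y @ z) = take N y" "drop N (y @ z) = drop N y @ z"
      "length (drop N y) = N * length ex" by auto
    with Cons.IH[of "drop N y"] show ?case
      by (auto simp: algebra_simps)
  qed
next
  case False
  then have "block_coeff N g ex j y = 0" "block_coeff N g ex (j - x) y = 0" "block_coeff N g (ex @ [x]) j (y @ z) = 0"
    using block_coeff_length[of ex _ y] block_coeff_length[of "ex @ [x]" j "y @ z"] assms
    by (auto simp: algebra_simps)
  then show ?thesis by simp
qed

abbreviation dual_prod where "dual_prod \<beta> \<equiv> prod_list (map r \<beta>)"

lemma keys_dual_prod: "w \<in> keys (dual_prod \<beta>) \<Longrightarrow> length w = N * length \<beta>"
proof (induction \<beta> arbitrary: w)
  case Nil
  then show ?case by (simp add: zero_list_def)
next
  case (Cons b \<beta>)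
  then show ?case by (auto elim!: keys_mult_list dest!: r_length)
qed

lemma pairing_block_prod_dual_prod:
  "length \<beta> = length \<beta>' \<Longrightarrow> pairing (block_prod N g \<beta>) (dual_prod \<beta>') = (if \<beta> = \<beta>' then 1 else 0)"
proof (induction \<beta> \<beta>' rule: list_induct2)
  case Nil
  then show ?case by (simp add: zero_list_def flip: single_one)
next
  case (Cons b \<beta> b' \<beta>')
  have "block_prod N g (b # \<beta>) = (\<lambda>w. g b (take N w) * block_prod N g \<beta> (drop N w))" by auto
  with Cons show ?case
    by (simp add: pairing_take_drop[OF r_length] dual)
qed

text \<open>A product of dual elements selects a single term of the expanded polynomial, so every
  exponent attained by \<open>dot\<close> has an element detecting its coefficient.\<close>

lemma pairing_block_coeff_dual_prod:
  "length \<beta> = length ex \<Longrightarrow> pairing (block_coeff N g ex j) (dual_prod \<beta>) = (if dot \<beta> ex = j then 1 else 0)"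
proof (induction \<beta> ex arbitrary: j rule: list_induct2)
  case Nil
  then show ?case by (simp add: zero_list_def flip: single_one)
next
  case (Cons b \<beta> x ex)
  have *: "block_coeff N g (x # ex) j = (\<lambda>w. g False (take N w) * block_coeff N g ex j (drop N w) +
     (if x \<le> j then 1 else 0) * (g True (take N w) * block_coeff N g ex (j - x) (drop N w)))" by auto
  show ?case unfolding *
    by (auto simp: pairing_fun_add pairing_fun_mult pairing_take_drop[OF r_length] dual Cons)
qed

text \<open>Expanding the polynomial writes each coefficient as a sum of block products, so
  functionals built from coefficients stay in the span of the old family.\<close>

lemma block_coeff_in_lspan: "block_coeff N g ex j \<in> lspan (block_prod N g ` {\<beta>. length \<beta> = length ex})"
proof (induction ex arbitrary: j)
  case Nil
  have "block_coeff N g [] j = (\<lambda>w. (if j = 0 then 1 else 0) * block_prod N g [] w)" by auto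
  also have "\<dots> \<in> lspan (block_prod N g ` {\<beta>. length \<beta> = length ([] :: nat list)})"
    by (intro lspan_scale lspan_base) auto
  finally show ?case .
next
  case (Cons x ex)
  let ?U = "block_prod N g ` {\<beta>. length \<beta> = length (x # ex)}"
  have *: "(\<lambda>w. g b (take N w) * block_coeff N g ex j (drop N w)) \<in> lspan ?U" for b j
  proof (rule lspan_product[where \<phi> = "take N" and \<psi> = "drop N", OF lspan_base[of _ "{g b}"] Cons])
    fix s s' assume "s \<in> {g b}" "s' \<in> block_prod N g ` {\<beta>. length \<beta> = length ex}"
    then obtain \<beta> where \<beta>: "s = g b" "s' = block_prod N g \<beta>" "length \<beta> = length ex" by auto
    then have "(\<lambda>w. s (take N w) * s' (drop N w)) = block_prod N g (b # \<beta>)" by auto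
    with \<beta> show "(\<lambda>w. s (take N w) * s' (drop N w)) \<in> lspan ?U"
      by (auto intro!: lspan_base image_eqI[of _ _ "b # \<beta>"])
  qed simp
  have eq: "block_coeff N g (x # ex) j = (\<lambda>w. (if x \<le> j then 1 else 0) * (g True (take N w) * block_coeff N g ex (j - x) (drop N w)) +
     g False (take N w) * block_coeff N g ex j (drop N w))" by auto
  show ?case unfolding eq by (rule lspan_lincomb[OF * *])
qed

section \<open>Reduction to short contexts\<close>

text \<open>A whole block lying in \<open>u\<close> or \<open>v\<close> only contributes scalars:
  stripping it shortens the exponent list at that end and lowers or keeps \<open>j\<close>. Hence
  the number of independent windows does not depend on the lengths of \<open>u\<close> and
  \<open>v\<close>.\<close>

lemma block_coeff_window_in_lspan:
  assumes tl: "\<And>x ex. x # ex \<in> X \<Longrightarrow> ex \<in> X" and bl: "\<And>x ex. ex @ [x] \<in> X \<Longrightarrow> ex \<in> X"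
    and "ex \<in> X" and "j < J"
  shows "(\<lambda>x. block_coeff N g ex j (u @ x @ v)) \<in>
    lspan {\<lambda>x. block_coeff N g ex j (u @ x @ v) | ex j u v. ex \<in> X \<and> j < J \<and> length u \<le> N \<and> length v \<le> N}"
    (is "_ \<in> lspan ?U")
  using assms(3,4)
proof (induction "length u + length v" arbitrary: ex j u v rule: less_induct)
  case less
  consider "length u \<le> N" "length v \<le> N" | "length u > N" | "length v > N" by linarith
  then show ?case
  proof cases
    case 1
    with less.prems show ?thesis by (intro lspan_base) blast
  next
    case 2
    show ?thesis
    proof (cases ex)
      case Nil
      then have "(\<lambda>x. block_coeff N g ex j (u @ x @ v)) = (\<lambda>x. 0)" using 2 by (auto simp: fun_eq_iff)
      then show ?thesis by (simp add: lspan_zero)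
    next
      case (Cons y ex')
      have eq: "(\<lambda>x. block_coeff N g ex j (u @ x @ v)) =
        (\<lambda>x. (if y \<le> j then g True (take N u) else 0) * block_coeff N g ex' (j - y) (drop N u @ x @ v)
          + g False (take N u) * block_coeff N g ex' j (drop N u @ x @ v))"
        using 2 by (auto simp: Cons)
      have "ex' \<in> X" using less.prems tl Cons by blast
      then show ?thesis unfolding eq using 2 less.prems N_pos
        by (intro lspan_lincomb lspan_scale less.hyps) auto
    qed
  next
    case 3
    show ?thesis
    proof (cases ex rule: rev_cases)
      case Nil
      then have "(\<lambda>x. block_coeff N g ex j (u @ x @ v)) = (\<lambda>x. 0)" using 3 by (auto simp: fun_eq_iff)
      then show ?thesis by (simp add: lspan_zero)
    next
      case (snoc ex' y)
      define v1 v2 where "v1 = take (length v - N) v" and "v2 = drop (length v - N) v"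
      have v: "v = v1 @ v2" "length v2 = N" "length v1 < length v"
        using 3 N_pos by (auto simp: v1_def v2_def)
      have "block_coeff N g ex j (u @ x @ v) =
          (if y \<le> j then g True v2 else 0) * block_coeff N g ex' (j - y) (u @ x @ v1)
          + g False v2 * block_coeff N g ex' j (u @ x @ v1)" for x
        using block_coeff_snoc[OF v(2), of ex' y j "u @ x @ v1"] by (simp add: snoc v(1))
      then have eq: "(\<lambda>x. block_coeff N g ex j (u @ x @ v)) = 
        (\<lambda>x. (if y \<le> j then g True v2 else 0) * block_coeff N g ex' (j - y) (u @ x @ v1)
          + g False v2 * block_coeff N g ex' j (u @ x @ v1))" by blast
      have "ex' \<in> X" using less.prems bl snoc by blast
      then show ?thesis unfolding eq using v less.prems
        by (intro lspan_lincomb lspan_scale less.hyps) auto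
    qed
  qed
qed

text \<open>Whole blocks contained in \<open>u\<close> or \<open>v\<close> factor out as scalars, so
  only contexts shorter than a block need checking.\<close>

lemma annihilates_reduce:
  assumes "\<And>\<beta> u v. length u < N \<Longrightarrow> length v < N \<Longrightarrow> pairing (\<lambda>w. block_prod N g \<beta> (u @ w @ v)) a = 0"
  shows "annihilates N g a"
  unfolding annihilates_def
proof (intro allI)
  fix \<beta> u v
  show "pairing (\<lambda>w. block_prod N g \<beta> (u @ w @ v)) a = 0"
  proof (induction "length u + length v" arbitrary: \<beta> u v rule: less_induct)
    case less
    consider "length u < N" "length v < N" | "length u \<ge> N" | "length v \<ge> N" by linarith
    then show ?case
    proof cases
      case 1
      then show ?thesis by (rule assms)
    next
      case 2
      show ?thesis
      proof (cases \<beta>)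
        case Nil
        with 2 N_pos show ?thesis by (intro pairing_eq_0) auto
      next
        case (Cons b \<beta>')
        with 2 N_pos less[of "drop N u" v \<beta>'] show ?thesis by (simp add: pairing_fun_mult)
      qed
    next
      case 3
      show ?thesis
      proof (cases \<beta> rule: rev_cases)
        case Nil
        with 3 N_pos show ?thesis by (intro pairing_eq_0) auto
      next
        case (snoc \<beta>' b)
        define v1 v2 where "v1 = take (length v - N) v" and "v2 = drop (length v - N) v"
        have v: "v = v1 @ v2" "length v2 = N" "length v1 < length v"
          using 3 N_pos by (auto simp: v1_def v2_def)
        have "block_prod N g \<beta> (u @ w @ v) = block_prod N g \<beta>' (u @ w @ v1) * block_prod N g [b] v2" for w
          using block_prod_append_right[of v2 "[b]" \<beta>' "u @ w @ v1"] by (simp add: snoc v)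
        then show ?thesis using less[of u v1 \<beta>'] v by (simp add: pairing_fun_mult_right)
      qed
    qed
  qed
qed

text \<open>A word of length at most \<open>N\<close> between contexts shorter than \<open>N\<close>
  meets at most two blocks. The functional is then a product of two windows of \<open>g\<close>, cut
  at some \<open>q\<close>; if there is only one block, the second factor is the indicator of the
  empty word.\<close>

lemma annihilates_bounded:
  assumes one: "\<And>b u v. (\<lambda>x. g b (u @ x @ v)) \<in> lspan \<Lambda>"
    and unit: "(\<lambda>x. if x = [] then 1 else 0) \<in> lspan \<Lambda>"
    and short: "\<And>w. w \<in> keys a \<Longrightarrow> length w \<le> N"
    and kill: "\<And>q l l'. q \<le> N \<Longrightarrow> l \<in> \<Lambda> \<Longrightarrow> l' \<in> \<Lambda> \<Longrightarrow> pairing (\<lambda>w. l (take q w) * l' (drop q w)) a = 0"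
  shows "annihilates N g a"
proof (rule annihilates_reduce)
  have kill': "pairing (\<lambda>w. l (take q w) * l' (drop q w)) a = 0"
    if "q \<le> N" "l \<in> lspan \<Lambda>" "l' \<in> lspan \<Lambda>" for q l l'
  proof (rule pairing_lspan_eq_0[OF lspan_product[OF that(2,3)]])
    show "\<And>s s'. s \<in> \<Lambda> \<Longrightarrow> s' \<in> \<Lambda> \<Longrightarrow> (\<lambda>w. s (take q w) * s' (drop q w))
      \<in> lspan {\<lambda>w. s (take q w) * s' (drop q w) | s s'. s \<in> \<Lambda> \<and> s' \<in> \<Lambda>}"
      by (rule lspan_base) blast
  qed (use kill that(1) in auto)
  fix \<beta> u v :: "bool list" assume u: "length u < N" and v: "length v < N"
  \<comment> \<open>Three or more blocks would need total length at least \<open>3 * N\<close>,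
    which the bounds on \<open>u\<close>, \<open>w\<close> and \<open>v\<close> exclude.\<close>
  consider "\<beta> = []" | b where "\<beta> = [b]" | b b' where "\<beta> = [b, b']" | "length \<beta> \<ge> 3"
    by (cases \<beta> rule: remdups_adj.cases) (auto simp: Suc_le_eq numeral_3_eq_3)
  then show "pairing (\<lambda>w. block_prod N g \<beta> (u @ w @ v)) a = 0"
  proof cases
    case 1
    have "pairing (\<lambda>w. block_prod N g \<beta> (u @ w @ v)) a =
      pairing (\<lambda>w. (if u = [] \<and> v = [] then 1 else 0) *
        ((if take N w = [] then 1 else 0) * (if drop N w = [] then 1 else 0))) a"
      using N_pos short by (intro pairing_cong) (auto simp: 1)
    also have "\<dots> = 0"
      unfolding pairing_fun_mult by (simp only: kill'[OF order_refl unit unit] mult_zero_right)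
    finally show ?thesis .
  next
    case 2
    have "pairing (\<lambda>w. block_prod N g \<beta> (u @ w @ v)) a =
      pairing (\<lambda>w. g b (u @ take N w @ v) * (if drop N w = [] then 1 else 0)) a"
    proof (rule pairing_cong)
      fix w assume "w \<in> keys a"
      then have w: "take N w = w" "drop N w = []" using short by auto
      show "block_prod N g \<beta> (u @ w @ v) = g b (u @ take N w @ v) * (if drop N w = [] then 1 else 0)"
        using g_length[of b "u @ w @ v"] unfolding w 2 by (cases "length (u @ w @ v) = N")
          (auto simp: block_prod_length dest!: g_length)
    qed
    also have "\<dots> = 0" by (rule kill'[OF order_refl one unit])
    finally show ?thesis .
  next
    case 3
    \<comment> \<open>The boundary between the two blocks, measured inside \<open>w\<close>.\<close>
    let ?q = "N - length u"
    have "pairing (\<lambda>w. block_prod N g \<beta> (u @ w @ v)) a =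
      pairing (\<lambda>w. g b (u @ take ?q w @ []) * g b' ([] @ drop ?q w @ v)) a"
    proof (rule pairing_cong)
      fix w assume "w \<in> keys a"
      show "block_prod N g \<beta> (u @ w @ v) = g b (u @ take ?q w @ []) * g b' ([] @ drop ?q w @ v)"
      proof (cases "length (u @ w @ v) = 2 * N")
        case True
        then have w: "length w \<ge> ?q" using u v by simp
        then have "take N (u @ w @ v) = u @ take ?q w" "drop N (u @ w @ v) = drop ?q w @ v"
          "length (drop ?q w @ v) = N"
          using u True by auto
        then show ?thesis by (simp add: 3)
      next
        case False
        then have "length (u @ w @ v) \<noteq> N * length \<beta>" by (simp add: 3)
        then have "block_prod N g \<beta> (u @ w @ v) = 0" using block_prod_length by blast
        moreover have "g b (u @ take ?q w) * g b' (drop ?q w @ v) = 0"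
        proof (rule ccontr)
          assume "\<not> ?thesis"
          then have "g b (u @ take ?q w) \<noteq> 0" "g b' (drop ?q w @ v) \<noteq> 0" by simp_all
          from g_length[OF this(1)] g_length[OF this(2)]
          have "length (u @ take ?q w) = N" "length (drop ?q w @ v) = N" by simp_all
          with u False show False by auto
        qed
        ultimately show ?thesis by simp
      qed
    qed
    also have "\<dots> = 0" by (rule kill'[OF _ one one]) simp
    finally show ?thesis .
  next
    case 4
    show ?thesis
    proof (rule pairing_eq_0, rule ccontr)
      fix w assume "w \<in> keys a" "block_prod N g \<beta> (u @ w @ v) \<noteq> 0"
      with block_prod_length[of \<beta> "u @ w @ v"] short
      have "length (u @ w @ v) = N * length \<beta>" "length w \<le> N" by blast+
      moreover have "N * length \<beta> \<ge> N * 3" using 4 by simp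
      ultimately show False using u v by simp
    qed
  qed
qed

end

section \<open>Nilpotency\<close>

text \<open>Cut each product of \<open>s\<close> words at its \<open>i\<close>-th factor and keep those whose first \<open>i\<close> factors have
  total length below \<open>n\<close>. By the hypothesis on \<open>g\<close>, the products whose next factor crosses the
  position \<open>n\<close> contribute nothing, so the resulting value does not depend on \<open>i\<close>.\<close>

lemma pairing_power_eq_0:
  fixes a :: "'w list \<Rightarrow>\<^sub>0 'k::field"
  assumes keys: "\<And>w. w \<in> keys a \<Longrightarrow> 1 \<le> length w \<and> length w \<le> d"
    and supp: "\<And>y. g y \<noteq> 0 \<Longrightarrow> length y = n"
    and rel: "\<And>s w. length w \<le> d \<Longrightarrow> pairing (\<lambda>z. g (z @ w)) (a ^ s) = 0"
    and "n > 0" and "n \<le> s"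
  shows "pairing (\<lambda>y. g (take n y) * q (drop n y)) (a ^ s) = 0"
proof -
  define H where "H y = g (take n y) * q (drop n y)" for y
  define I where "I i = pairing (\<lambda>z. if length z < n then pairing (\<lambda>y. H (z @ y)) (a ^ (s - i)) else 0) (a ^ i)" for i
  have step: "I i = I (Suc i)" if "i < s" for i
  proof -
    let ?b = "a ^ (s - Suc i)"
    have s: "a ^ (s - i) = a * ?b" using that by (metis Suc_diff_Suc power_Suc)
    let ?P = "\<lambda>z w. if length z < n then pairing (\<lambda>y. H (z @ w @ y)) ?b else 0"
    let ?Q = "\<lambda>z w. if length (z @ w) < n then pairing (\<lambda>y. H (z @ w @ y)) ?b else 0"
    \<comment> \<open>The contribution of the products whose next factor \<open>w\<close> crosses
      position \<open>n\<close>.\<close>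
    let ?D = "\<lambda>z w. if length z < n \<and> n \<le> length (z @ w) then pairing (\<lambda>y. H (z @ w @ y)) ?b else 0"
    have 1: "I i = pairing (\<lambda>z. pairing (?P z) a) (a ^ i)"
      unfolding I_def s pairing_mult_list[of _ a]
      by (intro pairing_cong) auto
    have 2: "I (Suc i) = pairing (\<lambda>z. pairing (?Q z) a) (a ^ i)"
      unfolding I_def power_Suc2 pairing_mult_list[of _ "a ^ i"]
      by (intro pairing_cong) simp
    have "?P z w = ?Q z w + ?D z w" for z w by auto
    then have "I i = I (Suc i) + pairing (\<lambda>z. pairing (?D z) a) (a ^ i)"
      unfolding 1 2 by (simp only: pairing_fun_add)
    also have "pairing (\<lambda>z. pairing (?D z) a) (a ^ i) = pairing (\<lambda>w. pairing (\<lambda>z. ?D z w) (a ^ i)) a"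
      by (rule pairing_swap)
    also have "\<dots> = 0"
    proof (rule pairing_eq_0)
      fix w assume w: "w \<in> keys a"
      \<comment> \<open>If \<open>k\<close> letters of \<open>w\<close> complete the prefix of
        length \<open>n\<close>, the rest of \<open>w\<close> and the later factors contribute
        \<open>c k\<close>. The support of \<open>g\<close> leaves only the right \<open>k\<close>
        in the sum below.\<close>
      define c where "c k = pairing (\<lambda>y. q (drop k w @ y)) ?b" for k
      have "?D z w = (\<Sum>k=1..length w. c k * g (z @ take k w))" for z
      proof (cases "length z < n \<and> n \<le> length (z @ w)")
        case True
        let ?k = "n - length z"
        have "(\<Sum>k=1..length w. c k * g (z @ take k w)) = (\<Sum>k=1..length w. if k = ?k then c k * g (z @ take k w) else 0)"
        proof (rule sum.cong[OF refl])
          fix k assume "k \<in> {1..length w}"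
          then show "c k * g (z @ take k w) = (if k = ?k then c k * g (z @ take k w) else 0)"
            using supp[of "z @ take k w"] True by auto
        qed
        also have "\<dots> = c ?k * g (z @ take ?k w)"
          using True by (subst sum.delta) auto
        also have "\<dots> = pairing (\<lambda>y. g (z @ take ?k w) * q (drop ?k w @ y)) ?b"
          by (simp add: pairing_fun_mult c_def)
        also have "\<dots> = pairing (\<lambda>y. H (z @ w @ y)) ?b"
          using True by (simp add: H_def)
        finally show ?thesis using True by simp
      next
        case False
        have "c k * g (z @ take k w) = 0" if "k \<in> {1..length w}" for k
          using supp[of "z @ take k w"] False that by auto
        then have "(\<Sum>k=1..length w. c k * g (z @ take k w)) = 0" by (rule sum.neutral[rule_format])
        with False show ?thesis by presburger
      qed
      then have "pairing (\<lambda>z. ?D z w) (a ^ i) =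
          (\<Sum>k=1..length w. c k * pairing (\<lambda>z. g (z @ take k w)) (a ^ i))"
        by (simp only: pairing_fun_sum pairing_fun_mult)
      also have "\<dots> = 0" using keys[OF w] by (intro sum.neutral) (auto intro: rel)
      finally show "pairing (\<lambda>z. ?D z w) (a ^ i) = 0" .
    qed
    finally show ?thesis by simp
  qed
  have "i \<le> s \<Longrightarrow> I 0 = I i" for i
    by (induction i) (auto simp: step)
  \<comment> \<open>\<open>I 0\<close> is the wanted value because \<open>n > 0\<close>; in
    \<open>I s\<close> every product already has length at least \<open>n\<close>.\<close>
  then have "I 0 = I s" by simp
  also have "I s = 0" unfolding I_def
  proof (rule pairing_eq_0)
    fix w assume "w \<in> keys (a ^ s)"
    then have "s \<le> length w" using length_keys_power[of a] keys by blast
    with \<open>n \<le> s\<close> show "(if length w < n then pairing (\<lambda>y. H (w @ y)) (a ^ (s - s)) else 0) = 0" by simp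
  qed
  finally show ?thesis using \<open>n > 0\<close> by (simp add: I_def H_def zero_list_def flip: single_one)
qed

context level begin

text \<open>At most \<open>N\<close> factors of the power are spent on moving the left context close
  to a block boundary, and \<open>N\<close> further factors are enough to cross the next block;
  hence the exponent \<open>2 * N\<close>.\<close>

lemma annihilates_power:
  assumes keys: "\<And>w. w \<in> keys a \<Longrightarrow> 1 \<le> length w \<and> length w \<le> d" and "d \<le> N"
    and rel: "\<And>b s u w. length u \<le> d \<Longrightarrow> length w \<le> d \<Longrightarrow> pairing (\<lambda>z. g b (u @ z @ w)) (a ^ s) = 0"
    and s: "s \<ge> 2 * N"
  shows "annihilates N g (a ^ s)"
proof (rule annihilates_reduce)
  have keys_pow: "s \<le> length w" if "w \<in> keys (a ^ s)" for w s
    using length_keys_power[of a] keys that by blast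
  \<comment> \<open>For a context shorter than \<open>d\<close> the first block absorbs
    \<open>u\<close> and a prefix of the power, and \<open>pairing_power_eq_0\<close> applies to
    \<open>g b (u @ _)\<close>.\<close>
  have near: "pairing (\<lambda>w. block_prod N g \<beta> (u @ w @ v)) (a ^ s) = 0" if "length u < d" "s \<ge> N" for s \<beta> and u v :: "bool list"
  proof (cases \<beta>)
    case Nil
    then show ?thesis using that N_pos by (intro pairing_eq_0) (auto dest!: keys_pow)
  next
    case (Cons b \<beta>')
    let ?n = "N - length u"
    have "pairing (\<lambda>w. block_prod N g \<beta> (u @ w @ v)) (a ^ s) =
      pairing (\<lambda>y. g b (u @ take ?n y) * block_prod N g \<beta>' (drop ?n y @ v)) (a ^ s)"
    proof (rule pairing_cong)
      fix w assume "w \<in> keys (a ^ s)"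
      then have "length w \<ge> N" using that keys_pow by fastforce
      then show "block_prod N g \<beta> (u @ w @ v) = g b (u @ take ?n w) * block_prod N g \<beta>' (drop ?n w @ v)"
        using that \<open>d \<le> N\<close> by (simp add: Cons)
    qed
    also have "\<dots> = 0"
      by (rule pairing_power_eq_0[where d = d and g = "\<lambda>y. g b (u @ y)" and q = "\<lambda>y. block_prod N g \<beta>' (y @ v)"])
        (use that keys rel \<open>d \<le> N\<close> in \<open>auto dest!: g_length\<close>)
    finally show ?thesis .
  qed
  \<comment> \<open>A longer context swallows factors of \<open>a\<close> one at a time until it
    passes the block boundary. The last factor overshoots by less than \<open>d\<close>, which is
    the situation of \<open>near\<close>.\<close>
  have far: "pairing (\<lambda>w. block_prod N g \<beta> (u @ w @ v)) (a ^ s) = 0"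
    if "length u < N" "s \<ge> N + (N - length u)" for s \<beta> and u v :: "bool list"
    using that
  proof (induction "N - length u" arbitrary: u s rule: less_induct)
    case less
    show ?case
    proof (cases "length u < d")
      case True
      then show ?thesis using less.prems by (intro near) auto
    next
      case False
      have s: "a ^ s = a * a ^ (s - 1)" using less.prems
        by (metis N_pos add_gr_0 less_le_trans power_eq_if neq0_conv)
      show ?thesis unfolding s pairing_mult_list
      proof (rule pairing_eq_0)
        fix x assume "x \<in> keys a"
        with keys have x: "1 \<le> length x" "length x \<le> d" by auto
        have *: "pairing (\<lambda>w. block_prod N g \<beta> ((u @ x) @ w @ v)) (a ^ (s - 1)) = 0"
        proof (cases "length (u @ x) < N")
          case True
          then show ?thesis using x less.prems by (intro less.hyps) auto
        next
          case long: False
          show ?thesis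
          proof (cases \<beta>)
            case Nil
            with long N_pos show ?thesis by (intro pairing_eq_0) auto
          next
            case (Cons b \<beta>')
            have "pairing (\<lambda>w. block_prod N g \<beta> ((u @ x) @ w @ v)) (a ^ (s - 1)) =
              g b (take N (u @ x)) * pairing (\<lambda>w. block_prod N g \<beta>' (drop N (u @ x) @ w @ v)) (a ^ (s - 1))"
              unfolding pairing_fun_mult[symmetric] using long less.prems by (simp add: Cons)
            moreover have "pairing (\<lambda>w. block_prod N g \<beta>' (drop N (u @ x) @ w @ v)) (a ^ (s - 1)) = 0"
              using long x less.prems by (intro near) auto
            ultimately show ?thesis by simp
          qed
        qed
        then show "pairing (\<lambda>w. block_prod N g \<beta> (u @ (x @ w) @ v)) (a ^ (s - 1)) = 0" by simp
      qed
    qed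
  qed
  fix \<beta> u v :: "bool list" assume "length u < N" "length v < N"
  then show "pairing (\<lambda>w. block_prod N g \<beta> (u @ w @ v)) (a ^ s) = 0"
    using s by (intro far) auto
qed

end

section \<open>Powers of the generic element\<close>

text \<open>The coefficient of a monomial in commuting variables in a power of the generic linear
  combination of words.\<close>

primrec mset_sum :: "nat \<Rightarrow> 'w list multiset \<Rightarrow> ('w list \<Rightarrow>\<^sub>0 'k::field)" where
  "mset_sum 0 \<mu> = 1"
| "mset_sum (Suc s) \<mu> = (\<Sum>w\<in>set_mset \<mu>. single w 1 * mset_sum s (\<mu> - {#w#}))"

text \<open>A multiset is determined by its multiplicities. The bound is polynomial in
  \<open>n\<close> of degree \<open>card X\<close>, which keeps the number of nilpotency conditions
  small.\<close>

lemma finite_bounded_multisets: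
  assumes "finite X"
  shows "finite {\<mu>. set_mset \<mu> \<subseteq> X \<and> size \<mu> \<le> n}"
    and "card {\<mu>. set_mset \<mu> \<subseteq> X \<and> size \<mu> \<le> n} \<le> (n + 1) ^ card X"
proof -
  let ?M = "{\<mu>. set_mset \<mu> \<subseteq> X \<and> size \<mu> \<le> n}"
  let ?f = "\<lambda>\<mu>. restrict (count \<mu>) X"
  have inj: "inj_on ?f ?M"
  proof (rule inj_onI)
    fix \<mu> \<nu> assume "\<mu> \<in> ?M" "\<nu> \<in> ?M" "?f \<mu> = ?f \<nu>"
    then have *: "set_mset \<mu> \<subseteq> X" "set_mset \<nu> \<subseteq> X" and **: "?f \<mu> x = ?f \<nu> x" for x
      by auto
    have "count \<mu> x = count \<nu> x" for x
    proof (cases "x \<in> X")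
      case True
      with **[of x] show ?thesis by simp
    next
      case False
      with * show ?thesis by (metis count_inI subsetD)
    qed
    then show "\<mu> = \<nu>" by (rule multiset_eqI)
  qed
  have sub: "?f ` ?M \<subseteq> X \<rightarrow>\<^sub>E {..n}"
  proof (rule image_subsetI)
    fix \<mu> assume "\<mu> \<in> ?M"
    then have "count \<mu> x \<le> n" for x using count_le_size[of \<mu> x] by simp
    then show "?f \<mu> \<in> X \<rightarrow>\<^sub>E {..n}" by simp
  qed
  have fin: "finite (X \<rightarrow>\<^sub>E {..n})" using assms by (intro finite_PiE) auto
  show "finite ?M" by (rule finite_imageD[OF finite_subset[OF sub fin] inj])
  have "card ?M = card (?f ` ?M)" by (rule card_image[OF inj, symmetric])
  also have "\<dots> \<le> card (X \<rightarrow>\<^sub>E {..n})" by (rule card_mono[OF fin sub])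
  also have "\<dots> = (n + 1) ^ card X" using assms by (simp add: card_PiE)
  finally show "card ?M \<le> (n + 1) ^ card X" .
qed

text \<open>Scalars commute, so terms of the power are grouped by the multiset of words used.
  Finitely many elements \<open>mset_sum s \<mu>\<close> thus control the \<open>s\<close>-th powers
  of all elements supported in \<open>X\<close>.\<close>

lemma power_eq_sum_mset_sum:
  fixes a :: "'w list \<Rightarrow>\<^sub>0 'k::field"
  assumes "finite X" and "keys a \<subseteq> X"
  shows "a ^ s = (\<Sum>\<mu> | set_mset \<mu> \<subseteq> X \<and> size \<mu> = s. smul (\<Prod>w\<in>#\<mu>. lookup a w) (mset_sum s \<mu>))"
proof (induction s)
  case 0
  have "{\<mu>. set_mset \<mu> \<subseteq> X \<and> size \<mu> = 0} = {{#}}" by auto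
  then show ?case by (simp add: smul_def)
next
  case (Suc s)
  let ?M = "\<lambda>s. {\<mu>. set_mset \<mu> \<subseteq> X \<and> size \<mu> = s}"
  let ?c = "\<lambda>\<mu>. \<Prod>w\<in>#\<mu>. lookup a w"
  have fin: "finite (?M s)" for s
    by (rule finite_subset[OF _ finite_bounded_multisets(1)[OF assms(1), of s]]) auto
  have a: "a = (\<Sum>w\<in>X. smul (lookup a w) (single w 1))"
    unfolding smul_single mult_1_right
    by (subst poly_mapping_eq_sum_single[of a])
      (use assms in \<open>auto intro!: sum.mono_neutral_left simp: in_keys_iff\<close>)
  have "a ^ Suc s = (\<Sum>w\<in>X. smul (lookup a w) (single w 1)) * (\<Sum>\<nu>\<in>?M s. smul (?c \<nu>) (mset_sum s \<nu>))"
    using Suc.IH a by simp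
  also have "\<dots> = (\<Sum>(w, \<nu>)\<in>X \<times> ?M s. smul (lookup a w * ?c \<nu>) (single w 1 * mset_sum s \<nu>))"
    by (simp add: sum_product sum.cartesian_product smul_mult_left smul_mult_right mult.commute)
  also have "\<dots> = (\<Sum>(\<mu>, w)\<in>(SIGMA \<mu>:?M (Suc s). set_mset \<mu>). smul (?c \<mu>) (single w 1 * mset_sum s (\<mu> - {#w#})))"
  \<comment> \<open>A first factor with the multiset of the others corresponds to a multiset with a
    distinguished member.\<close>
  proof (rule sum.reindex_bij_witness[where j = "\<lambda>(w, \<nu>). (add_mset w \<nu>, w)" and i = "\<lambda>(\<mu>, w). (w, \<mu> - {#w#})"])
    fix p assume "p \<in> (SIGMA \<mu>:?M (Suc s). set_mset \<mu>)"
    then show "(case p of (\<mu>, w) \<Rightarrow> (w, \<mu> - {#w#})) \<in> X \<times> ?M s"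
      by (auto simp: size_Diff_singleton dest: in_diffD)
  qed auto
  also have "\<dots> = (\<Sum>\<mu>\<in>?M (Suc s). smul (?c \<mu>) (mset_sum (Suc s) \<mu>))"
  proof -
    have "smul c (sum f A) = (\<Sum>x\<in>A. smul c (f x))" for c and f :: "'w list \<Rightarrow> 'w list \<Rightarrow>\<^sub>0 'k" and A
      unfolding smul_def by (rule sum_distrib_left)
    then show ?thesis using fin by (simp add: sum.Sigma)
  qed
  finally show ?case .
qed

section \<open>The next level\<close>

primrec digit_exponents :: "nat \<Rightarrow> nat \<Rightarrow> nat list" where
  "digit_exponents t 0 = []"
| "digit_exponents t (Suc e) = digit_exponents t e @ replicate t ((t + 1) ^ e)"

lemma length_digit_exponents [simp]: "length (digit_exponents t e) = e * t"
  by (induction e) auto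

lemma dot_append: "length \<beta> = length ex \<Longrightarrow> dot (\<beta> @ \<beta>') (ex @ ex') = dot \<beta> ex + dot \<beta>' ex'"
  by (induction \<beta> ex rule: list_induct2) auto

lemma dot_replicate: "dot (replicate n b) (replicate n x) = (if b then n * x else 0)"
  by (induction n) auto

text \<open>Each power of \<open>t + 1\<close> occurs \<open>t\<close> times, so switching on some
  of its copies realises any base \<open>t + 1\<close> digit.\<close>

lemma dot_digit_exponents_surj:
  "j < (t + 1) ^ e \<Longrightarrow> \<exists>\<beta>. length \<beta> = e * t \<and> dot \<beta> (digit_exponents t e) = j"
proof (induction e arbitrary: j)
  case (Suc e)
  let ?c = "(t + 1) ^ e"
  \<comment> \<open>The leading digit, realised by that many \<open>True\<close> entries in the last
    \<open>t\<close> blocks.\<close>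
  define \<delta> where "\<delta> = j div ?c"
  have \<delta>: "\<delta> \<le> t" using Suc.prems unfolding \<delta>_def
    by (metis Suc_eq_plus1 less_Suc_eq_le less_mult_imp_div_less power_Suc)
  obtain \<beta> where \<beta>: "length \<beta> = e * t" "dot \<beta> (digit_exponents t e) = j mod ?c"
    using Suc.IH[of "j mod ?c"] by auto
  let ?\<beta> = "\<beta> @ replicate \<delta> True @ replicate (t - \<delta>) False"
  have "replicate t ?c = replicate \<delta> ?c @ replicate (t - \<delta>) ?c"
    using \<delta> by (simp add: replicate_add[symmetric])
  then have "dot ?\<beta> (digit_exponents t (Suc e)) = j mod ?c + \<delta> * ?c"
    using \<beta> by (simp add: dot_append dot_replicate)
  also have "\<dots> = j" unfolding \<delta>_def by (rule mod_div_mult_eq)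
  finally show ?case using \<beta>(1) \<delta> by (intro exI[of _ ?\<beta>]) auto
qed simp

lemma bool_lists_length_le:
  "finite {w :: bool list. length w \<le> d}" "card {w :: bool list. length w \<le> d} \<le> 2 ^ (d + 1)"
proof -
  have eq: "{w :: bool list. length w \<le> d} = {w. set w \<subseteq> UNIV \<and> length w \<le> d}" by auto
  show "finite {w :: bool list. length w \<le> d}"
    unfolding eq by (rule finite_lists_length_le) simp
  have "card {w :: bool list. length w \<le> d} = (\<Sum>i\<le>d. 2 ^ i)"
    unfolding eq by (subst card_lists_length_le) auto
  also have "\<dots> \<le> 2 ^ (d + 1)"
    by (induction d) auto
  finally show "card {w :: bool list. length w \<le> d} \<le> 2 ^ (d + 1)" .
qed

lemma contiguous_sublists:
  fixes xs :: "'a list"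
  shows "finite {ys. \<exists>p q. xs = p @ ys @ q}" and "card {ys. \<exists>p q. xs = p @ ys @ q} \<le> (length xs + 1)\<^sup>2"
proof -
  have sub: "{ys. \<exists>p q. xs = p @ ys @ q} \<subseteq> (\<lambda>(i, k). take k (drop i xs)) ` ({..length xs} \<times> {..length xs})"
  proof clarify
    fix ys p q assume "xs = p @ ys @ q"
    then show "ys \<in> (\<lambda>(i, k). take k (drop i (p @ ys @ q))) ` ({..length (p @ ys @ q)} \<times> {..length (p @ ys @ q)})"
      by (intro image_eqI[of _ _ "(length p, length ys)"]) auto
  qed
  show "finite {ys. \<exists>p q. xs = p @ ys @ q}" by (rule finite_subset[OF sub]) simp
  have "card {ys. \<exists>p q. xs = p @ ys @ q} \<le> card ({..length xs} \<times> {..length xs})"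
    by (rule surj_card_le[OF _ sub]) simp
  then show "card {ys. \<exists>p q. xs = p @ ys @ q} \<le> (length xs + 1)\<^sup>2"
    by (simp add: power2_eq_square)
qed

section \<open>Combining block coefficients into new functionals\<close>

context level begin

definition combine :: "nat list \<Rightarrow> nat \<Rightarrow> (bool \<Rightarrow> nat \<Rightarrow> 'k) \<Rightarrow> bool \<Rightarrow> bool list \<Rightarrow> 'k" where
  "combine ex J cf b w = (\<Sum>j<J. cf b j * block_coeff N g ex j w)"

lemma level_combine:
  assumes "ex \<noteq> []" and "\<And>b. length (\<beta>s b) = length ex" and "\<And>b. dot (\<beta>s b) ex < J"
    and "\<And>b b'. cf b (dot (\<beta>s b') ex) = (if b = b' then 1 else 0)"
  shows "level (N * length ex) (combine ex J cf) (\<lambda>b. dual_prod (\<beta>s b))"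
proof
  show "N * length ex > 0" using N_pos assms by simp
  show "length w = N * length ex" if "combine ex J cf b w \<noteq> 0" for b w
  proof (rule ccontr)
    assume "length w \<noteq> N * length ex"
    then have "block_coeff N g ex j w = 0" for j using block_coeff_length by blast
    with that show False by (simp add: combine_def)
  qed
  show "length w = N * length ex" if "w \<in> keys (dual_prod (\<beta>s b))" for b w
    using keys_dual_prod[OF that] assms by simp
  show "pairing (combine ex J cf b) (dual_prod (\<beta>s b')) = (if b = b' then 1 else 0)" for b b'
    unfolding combine_def pairing_fun_sum pairing_fun_mult pairing_block_coeff_dual_prod[OF assms(2)]
    using assms(3,4) by (simp add: if_distrib[of "\<lambda>x. _ * x"] cong: if_cong)
qed

lemma combine_in_lspan: "combine ex J cf b \<in> lspan (block_prod N g ` {\<beta>. length \<beta> = length ex})"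
proof -
  have "combine ex J cf b = (\<lambda>w. \<Sum>j<J. cf b j * block_coeff N g ex j w)"
    by (simp add: combine_def fun_eq_iff)
  then show ?thesis by (simp add: lspan_sum lspan_scale block_coeff_in_lspan)
qed

text \<open>Products of new functionals expand into products of old ones with more blocks, so
  whatever the old level annihilates is annihilated by the new one.\<close>

lemma block_prod_combine_in_lspan:
  "block_prod (N * length ex) (combine ex J cf) \<beta> \<in> lspan (range (block_prod N g))"
proof (induction \<beta>)
  case Nil
  have "block_prod (N * length ex) (combine ex J cf) [] = block_prod N g []" by auto
  then show ?case by (metis lspan_base rangeI)
next
  case (Cons b \<beta>)
  let ?N = "N * length ex"
  have "(\<lambda>w. combine ex J cf b (take ?N w) * block_prod ?N (combine ex J cf) \<beta> (drop ?N w)) \<in> lspan (range (block_prod N g))"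
  proof (rule lspan_product[OF combine_in_lspan Cons])
    fix s s' assume "s \<in> block_prod N g ` {\<beta>. length \<beta> = length ex}" "s' \<in> range (block_prod N g)"
    then obtain \<beta>1 \<beta>2 where s: "s = block_prod N g \<beta>1" "s' = block_prod N g \<beta>2" "length \<beta>1 = length ex" by auto
    have "s (take ?N w) * s' (drop ?N w) = block_prod N g (\<beta>1 @ \<beta>2) w" for w
    proof (cases "length w < ?N")
      case True
      then have "length (take ?N w) \<noteq> N * length \<beta>1" "length w \<noteq> N * length (\<beta>1 @ \<beta>2)"
        by (simp_all add: s algebra_simps)
      then have "block_prod N g \<beta>1 (take ?N w) = 0" "block_prod N g (\<beta>1 @ \<beta>2) w = 0"
        using block_prod_length by blast+
      then show ?thesis by (simp add: s)
    next
      case False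
      then show ?thesis using block_prod_append_left[of "take ?N w" \<beta>1 \<beta>2 "drop ?N w"] s by simp
    qed
    then show "(\<lambda>w. s (take ?N w) * s' (drop ?N w)) \<in> lspan (range (block_prod N g))"
      by (simp add: lspan_base)
  qed
  moreover have "block_prod ?N (combine ex J cf) (b # \<beta>) =
      (\<lambda>w. combine ex J cf b (take ?N w) * block_prod ?N (combine ex J cf) \<beta> (drop ?N w))" by auto
  ultimately show ?case by simp
qed

lemma annihilates_combine:
  assumes "annihilates N g a"
  shows "annihilates (N * length ex) (combine ex J cf) a"
  unfolding annihilates_def
proof (intro allI)
  fix \<beta> u v
  have "(\<lambda>w. block_prod (N * length ex) (combine ex J cf) \<beta> (u @ w @ v)) \<in>
      lspan {\<lambda>w. block_prod N g \<beta> (u @ w @ v) | \<beta>. True}"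
    by (rule lspan_compose[OF block_prod_combine_in_lspan]) (auto intro!: lspan_base)
  then show "pairing (\<lambda>w. block_prod (N * length ex) (combine ex J cf) \<beta> (u @ w @ v)) a = 0"
    by (rule pairing_lspan_eq_0) (use assms in \<open>auto simp: annihilates_def\<close>)
qed

text \<open>The assumption \<open>room\<close> says that the nilpotency conditions number at least
  two fewer than the \<open>(t + 1) ^ e\<close> coefficients, so elimination leaves two
  combinations. The set \<open>\<Lambda>\<close> records how few functionals decide annihilation up
  to length \<open>M\<close>.\<close>

lemma next_level:
  fixes e d t :: nat
  defines "X \<equiv> {w :: bool list. 1 \<le> length w \<and> length w \<le> d}"
  defines "M \<equiv> N * (e * t)"
  assumes pos: "e * t > 0" and "d \<le> M"
    and room: "(2 ^ (d + 1))\<^sup>2 * (M + 1) ^ card X + 2 \<le> (t + 1) ^ e"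
  shows "\<exists>g' r' \<Lambda>. level M g' r' \<and> (\<forall>a. annihilates N g a \<longrightarrow> annihilates M g' a) \<and>
    (\<forall>a s. keys a \<subseteq> X \<and> s \<ge> 2 * M \<longrightarrow> annihilates M g' (a ^ s)) \<and>
    finite \<Lambda> \<and> card \<Lambda> \<le> (M + 1) * ((e * t + 1)\<^sup>2 * (t + 1) ^ e * (2 ^ (N + 1))\<^sup>2)\<^sup>2 \<and>
    (\<forall>a. (\<forall>w\<in>keys a. length w \<le> M) \<and> (\<forall>l\<in>\<Lambda>. pairing l a = 0) \<longrightarrow> annihilates M g' a)"
proof -
  define ex where "ex = digit_exponents t e"
  define J where "J = (t + 1) ^ e"
  have M: "M = N * length ex" and ex: "ex \<noteq> []"
    using pos by (auto simp: M_def ex_def simp flip: length_greater_0_conv)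
  have fX: "finite X" by (rule finite_subset[OF _ bool_lists_length_le(1)[of d]]) (auto simp: X_def)
  let ?W = "{w :: bool list. length w \<le> d}"
  let ?M = "{\<mu>. set_mset \<mu> \<subseteq> X \<and> size \<mu> \<le> M}"
  \<comment> \<open>One condition for each pair of contexts of length at most \<open>d\<close> and
    each monomial of degree at most \<open>M\<close> in the generic element, as a vector indexed by
    the coefficient \<open>j\<close>.\<close>
  define \<rho> where "\<rho> = (\<lambda>(u, w, \<mu>) j. pairing (\<lambda>z. block_coeff N g ex j (u @ z @ w)) (mset_sum (size \<mu>) \<mu>))"
  define R where "R = \<rho> ` (?W \<times> ?W \<times> ?M)"
  have fR: "finite R" unfolding R_def
    using bool_lists_length_le(1) finite_bounded_multisets(1)[OF fX] by auto
  have "card R \<le> card (?W \<times> ?W \<times> ?M)" unfolding R_def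
    using bool_lists_length_le(1) finite_bounded_multisets(1)[OF fX] by (intro card_image_le) auto
  also have "\<dots> = (card ?W)\<^sup>2 * card ?M" by (simp add: card_cartesian_product power2_eq_square)
  also have "\<dots> \<le> (2 ^ (d + 1))\<^sup>2 * (M + 1) ^ card X"
    by (intro mult_mono power_mono bool_lists_length_le finite_bounded_multisets fX) auto
  finally have cR: "card R + 2 \<le> J" using room by (simp add: J_def)
  obtain I cf where I: "I \<subseteq> {..<J}" "card I \<le> card R"
    and cf: "\<And>i j. j \<in> {..<J} - I \<Longrightarrow> i \<in> {..<J} - I \<Longrightarrow> cf j i = (if i = j then 1 else 0)"
    and kill: "\<And>j \<rho>. j \<in> {..<J} - I \<Longrightarrow> \<rho> \<in> R \<Longrightarrow> (\<Sum>i<J. cf j i * \<rho> i) = 0"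
    using elimination[OF fR finite_lessThan[of J]] by blast
  \<comment> \<open>Two indices that are not pivots become the two functionals of the new
    level.\<close>
  have "2 \<le> card ({..<J} - I)"
    using I cR by (subst card_Diff_subset) (auto intro: finite_subset[OF I(1)])
  then obtain S where "S \<subseteq> {..<J} - I" "card S = 2"
    by (metis obtain_subset_with_card_n)
  then obtain j0 j1 where j: "j0 \<in> {..<J} - I" "j1 \<in> {..<J} - I" "j0 \<noteq> j1"
    by (auto simp: card_2_iff)
  define jj where "jj b = (if b then j1 else j0)" for b :: bool
  have jj: "jj b \<in> {..<J} - I" "jj b = jj b' \<longleftrightarrow> b = b'" for b b'
    using j by (auto simp: jj_def)
  have "\<exists>\<beta>. length \<beta> = length ex \<and> dot \<beta> ex = jj b" for b
    using dot_digit_exponents_surj[of "jj b" t e] jj(1)[of b] by (auto simp: J_def ex_def)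
  then obtain \<beta>s where \<beta>s: "\<And>b. length (\<beta>s b) = length ex" "\<And>b. dot (\<beta>s b) ex = jj b" by metis
  define g' where "g' = combine ex J (\<lambda>b. cf (jj b))"
  interpret nx: level M g' "\<lambda>b. dual_prod (\<beta>s b)"
    unfolding M g'_def
  proof (rule level_combine[OF ex \<beta>s(1)])
    show "dot (\<beta>s b) ex < J" for b using \<beta>s(2) jj(1)[of b] by simp
    show "cf (jj b) (dot (\<beta>s b') ex) = (if b = b' then 1 else 0)" for b b'
      unfolding \<beta>s(2) using cf[OF jj(1) jj(1)] jj(2)[of b' b] by auto
  qed
  have nilp: "annihilates M g' (a ^ s)" if a: "keys a \<subseteq> X" and s: "s \<ge> 2 * M" for a s
  proof (rule nx.annihilates_power[OF _ \<open>d \<le> M\<close> _ s])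
    show keys: "1 \<le> length w \<and> length w \<le> d" if "w \<in> keys a" for w
      using a that by (auto simp: X_def)
    fix b s and u w :: "bool list" assume uw: "length u \<le> d" "length w \<le> d"
    show "pairing (\<lambda>z. g' b (u @ z @ w)) (a ^ s) = 0"
    proof (cases "s \<le> M")
      case True
      have *: "(\<Sum>j<J. cf (jj b) j * pairing (\<lambda>z. block_coeff N g ex j (u @ z @ w)) (mset_sum s \<mu>)) = 0"
        if "set_mset \<mu> \<subseteq> X \<and> size \<mu> = s" for \<mu>
      proof -
        have "\<rho> (u, w, \<mu>) \<in> R" unfolding R_def using that uw True by auto
        from kill[OF jj(1) this, of b] show ?thesis using that by (simp add: \<rho>_def)
      qed
      have "pairing (\<lambda>z. g' b (u @ z @ w)) (smul c (mset_sum s \<mu>)) = 0"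
        if "set_mset \<mu> \<subseteq> X \<and> size \<mu> = s" for c \<mu>
      proof -
        have "pairing (\<lambda>z. g' b (u @ z @ w)) (smul c (mset_sum s \<mu>)) = c *
            (\<Sum>j<J. cf (jj b) j * pairing (\<lambda>z. block_coeff N g ex j (u @ z @ w)) (mset_sum s \<mu>))"
          unfolding pairing_smul g'_def combine_def pairing_fun_sum pairing_fun_mult
          by (simp add: sum_distrib_left mult.left_commute)
        with that * show ?thesis by simp
      qed
      then show ?thesis
        unfolding power_eq_sum_mset_sum[OF fX a] pairing_sum by (intro sum.neutral) blast
    next
      case False
      \<comment> \<open>No condition was imposed for these exponents: all words are too long for the
        support of \<open>g'\<close>.\<close>
      have "length x > M" if "x \<in> keys (a ^ s)" for x
        using length_keys_power[of a x s] keys that False by fastforce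
      then show ?thesis
        by (intro pairing_eq_0) (use nx.g_length in fastforce)
    qed
  qed
  have mono: "annihilates M g' a" if "annihilates N g a" for a
    unfolding M g'_def by (rule annihilates_combine[OF that])
  define sl where "sl = {ys. \<exists>p q. ex = p @ ys @ q}"
  let ?V = "{w :: bool list. length w \<le> N}"
  define \<Lambda>1 where "\<Lambda>1 = {\<lambda>x. block_coeff N g ex' j (u @ x @ v) | ex' j u v. ex' \<in> sl \<and> j < J \<and> length u \<le> N \<and> length v \<le> N}"
  \<comment> \<open>All cut positions with one window functional on each side, as
    \<open>annihilates_bounded\<close> requires.\<close>
  define \<Lambda> where "\<Lambda> = (\<lambda>(q, l, l') w. l (take q w) * l' (drop q w)) ` ({..M} \<times> \<Lambda>1 \<times> \<Lambda>1)"
  have \<Lambda>1: "\<Lambda>1 = (\<lambda>(ex', j, u, v) x. block_coeff N g ex' j (u @ x @ v)) ` (sl \<times> {..<J} \<times> ?V \<times> ?V)"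
    unfolding \<Lambda>1_def by force
  have f1: "finite \<Lambda>1" unfolding \<Lambda>1 sl_def
    using bool_lists_length_le(1) contiguous_sublists(1)[of ex] by auto
  then have f2: "finite \<Lambda>" by (simp add: \<Lambda>_def)
  have "card \<Lambda>1 \<le> card (sl \<times> {..<J} \<times> ?V \<times> ?V)" unfolding \<Lambda>1 sl_def
    using bool_lists_length_le(1) contiguous_sublists(1)[of ex] by (intro card_image_le) auto
  also have "\<dots> = card sl * J * (card ?V)\<^sup>2" by (simp add: card_cartesian_product power2_eq_square)
  also have "\<dots> \<le> (e * t + 1)\<^sup>2 * (t + 1) ^ e * (2 ^ (N + 1))\<^sup>2"
    using contiguous_sublists(2)[of ex]
    by (intro mult_mono power_mono bool_lists_length_le) (auto simp: sl_def J_def ex_def)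
  finally have c1: "card \<Lambda>1 \<le> (e * t + 1)\<^sup>2 * (t + 1) ^ e * (2 ^ (N + 1))\<^sup>2" .
  have "card \<Lambda> \<le> card ({..M} \<times> \<Lambda>1 \<times> \<Lambda>1)" unfolding \<Lambda>_def
    using f1 by (intro card_image_le) auto
  also have "\<dots> = (M + 1) * (card \<Lambda>1)\<^sup>2" by (simp add: card_cartesian_product power2_eq_square)
  also have "\<dots> \<le> (M + 1) * ((e * t + 1)\<^sup>2 * (t + 1) ^ e * (2 ^ (N + 1))\<^sup>2)\<^sup>2"
    using c1 by (intro mult_mono power_mono) auto
  finally have c2: "card \<Lambda> \<le> (M + 1) * ((e * t + 1)\<^sup>2 * (t + 1) ^ e * (2 ^ (N + 1))\<^sup>2)\<^sup>2" .
  have bounded: "annihilates M g' a" if short: "\<forall>w\<in>keys a. length w \<le> M" and l: "\<forall>l\<in>\<Lambda>. pairing l a = 0" for a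
  proof (rule nx.annihilates_bounded[where \<Lambda> = \<Lambda>1])
    have window: "(\<lambda>x. block_coeff N g ex' j (u @ x @ v)) \<in> lspan \<Lambda>1" if "ex' \<in> sl" "j < J" for ex' j u v
      unfolding \<Lambda>1_def
    proof (rule block_coeff_window_in_lspan[OF _ _ that])
      show "ex' \<in> sl" if "x # ex' \<in> sl" for x ex'
        using that unfolding sl_def by clarsimp (metis append.assoc append_Cons append_Nil)
      show "ex' \<in> sl" if "ex' @ [x] \<in> sl" for x ex'
        using that unfolding sl_def by auto
    qed
    show "(\<lambda>x. g' b (u @ x @ v)) \<in> lspan \<Lambda>1" for b u v
      unfolding g'_def combine_def
      by (intro lspan_sum lspan_scale window) (auto simp: sl_def intro: exI[of _ "[]"])
    \<comment> \<open>The empty exponent list with \<open>j = 0\<close> gives the indicator of the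
      empty word.\<close>
    have "[] \<in> sl" "0 < J" by (auto simp: sl_def J_def)
    from window[OF this, of "[]" "[]"] show "(\<lambda>x. if x = [] then 1 else 0) \<in> lspan \<Lambda>1" by simp
    show "length w \<le> M" if "w \<in> keys a" for w using short that by blast
    show "pairing (\<lambda>w. l (take q w) * l' (drop q w)) a = 0" if "q \<le> M" "l \<in> \<Lambda>1" "l' \<in> \<Lambda>1" for q l l'
    proof -
      have "(\<lambda>w. l (take q w) * l' (drop q w)) \<in> \<Lambda>" unfolding \<Lambda>_def
        by (rule image_eqI[of _ _ "(q, l, l')"]) (use that in auto)
      with \<open>\<forall>l\<in>\<Lambda>. pairing l a = 0\<close> show ?thesis by blast
    qed
  qed
  show ?thesis
    using nx.level_axioms f2 c2 nilp mono bounded by (intro exI[of _ g'] exI[of _ "\<lambda>b. dual_prod (\<beta>s b)"] exI[of _ \<Lambda>]) blast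
qed

end

section \<open>A nil ideal with oscillating codimension\<close>

text \<open>Eventually \<open>f n\<close> is below the \<open>n\<close>-th power of the
  \<open>(N + 1)\<close>-th root of 2, and \<open>N * e + 1 \<le> (N + 1) * e\<close>. The shift by
  1 anticipates the module unit, which counts as a letter in Lie monomials.\<close>

lemma subexponential_le_power2:
  assumes "subexponential f" and "N > 0"
  shows "\<exists>e > K. f (N * e + 1) \<le> 2 ^ e"
proof -
  define \<epsilon> where "\<epsilon> = root (N + 1) (2::real)"
  have \<epsilon>: "\<epsilon> > 1" "\<epsilon> ^ (N + 1) = 2"
    using real_root_pow_pos2[of "N + 1" 2] by (simp_all add: \<epsilon>_def del: power_Suc)
  have "limsup (\<lambda>n. ereal (root n (real (f n)))) < ereal \<epsilon>"
    using assms(1) \<epsilon>(1) by (simp add: subexponential_def one_ereal_def)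
  then have "eventually (\<lambda>n. ereal (root n (real (f n))) < ereal \<epsilon>) sequentially"
    by (rule Limsup_lessD)
  then obtain n0 where n0: "\<And>n. n \<ge> n0 \<Longrightarrow> root n (real (f n)) < \<epsilon>"
    by (auto simp: eventually_sequentially)
  define e where "e = Suc (max K n0)"
  have e: "e > K" "e \<ge> n0" "e > 0" by (auto simp: e_def)
  let ?n = "N * e + 1"
  have "n0 \<le> ?n" using e assms(2) by (metis Suc_eq_plus1 Suc_leD le_SucI le_trans mult.commute mult_le_mono2 nat_mult_1_right One_nat_def Suc_leI)
  then have "root ?n (real (f ?n)) < \<epsilon>" by (rule n0)
  then have "root ?n (real (f ?n)) ^ ?n \<le> \<epsilon> ^ ?n"
    by (intro power_mono) auto
  then have "real (f ?n) \<le> \<epsilon> ^ ?n" by (simp add: real_root_pow_pos2 del: power_Suc)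
  also have "\<dots> \<le> \<epsilon> ^ ((N + 1) * e)"
    using \<epsilon>(1) e by (intro power_increasing) auto
  also have "\<dots> = 2 ^ e" by (simp only: power_mult \<epsilon>(2))
  finally have "f ?n \<le> 2 ^ e" by (metis of_nat_le_iff of_nat_numeral of_nat_power)
  with e show ?thesis by blast
qed

lemma super_polynomial_ge:
  assumes "super_polynomial \<omega>"
  shows "\<exists>n0. \<forall>n\<ge>n0. K * n ^ q \<le> \<omega> n"
proof -
  \<comment> \<open>The exponent \<open>Suc q\<close> is positive even when
    \<open>q = 0\<close>.\<close>
  have "filterlim (\<lambda>n. real (\<omega> n) / real n powr (real (Suc q))) at_top sequentially"
    using assms unfolding super_polynomial_def by auto
  then have "eventually (\<lambda>n. real (\<omega> n) / real n powr (real (Suc q)) \<ge> K) sequentially"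
    by (simp add: filterlim_at_top)
  then obtain n1 where n1: "\<And>n. n \<ge> n1 \<Longrightarrow> real (\<omega> n) / real n powr (real (Suc q)) \<ge> K"
    by (auto simp: eventually_sequentially)
  have "K * n ^ q \<le> \<omega> n" if "n \<ge> Suc n1" for n
  proof -
    have n: "n > 0" using that by simp
    then have "real K \<le> real (\<omega> n) / real n ^ Suc q"
      using n1[of n] that by (simp add: powr_realpow del: of_nat_Suc power_Suc)
    then have "real K * real n ^ Suc q \<le> real (\<omega> n)"
      using n by (simp add: pos_le_divide_eq del: power_Suc)
    then have "real (K * n ^ Suc q) \<le> real (\<omega> n)" by simp
    then have "K * n ^ Suc q \<le> \<omega> n" by (simp only: of_nat_le_iff)
    moreover have "n ^ q \<le> n ^ Suc q" using n by simp
    ultimately show ?thesis by (meson le_trans mult_le_mono2)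
  qed
  then show ?thesis by blast
qed

text \<open>As \<open>e\<close> is fixed before \<open>t\<close>, the first estimate compares degree
  \<open>D\<close> with the larger degree \<open>e\<close> in \<open>t\<close>, and the second
  compares degree \<open>2 * e + 5\<close> in \<open>M\<close> with a super-polynomial
  function.\<close>

lemma parameter_exists:
  fixes N e d D :: nat
  assumes "super_polynomial \<omega>" and "N > 0" and "e > D"
  shows "\<exists>t. let M = N * (e * t) in e * t > 0 \<and> N * e \<le> M \<and> d \<le> M \<and>
    (2 ^ (d + 1))\<^sup>2 * (M + 1) ^ D + 2 \<le> (t + 1) ^ e \<and>
    2 * ((M + 1) * ((e * t + 1)\<^sup>2 * (t + 1) ^ e * (2 ^ (N + 1))\<^sup>2)\<^sup>2 + 2 ^ (N * e + 1)) \<le> \<omega> M"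
proof -
  define c :: nat where "c = (2 ^ (N + 1))\<^sup>2"
  define C :: nat where "C = 2 ^ (N * e + 1)"
  define K1 :: nat where "K1 = (2 ^ (d + 1))\<^sup>2 * (N * e + 1) ^ D + 2"
  define K2 where "K2 = 2 * (2 ^ (2 * e + 5) * c\<^sup>2 + C)"
  obtain n0 where n0: "\<And>n. n \<ge> n0 \<Longrightarrow> K2 * n ^ (2 * e + 5) \<le> \<omega> n"
    using super_polynomial_ge[OF assms(1)] by blast
  \<comment> \<open>Large enough to pass \<open>n0\<close> and \<open>d\<close> and to absorb the
    constant \<open>K1\<close> into one more power of \<open>t + 1\<close>.\<close>
  define t where "t = 1 + n0 + d + K1"
  define M where "M = N * (e * t)"
  have e: "e \<ge> 1" using assms by simp
  have et: "e * t \<ge> t" using e by simp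
  have Me: "M \<ge> e * t" using assms(2) by (simp add: M_def)
  have M: "M \<ge> t" using et Me by linarith
  have t: "t \<ge> 1" "t \<ge> n0" "t \<ge> d" "t \<ge> K1" by (auto simp: t_def)
  have "(2 ^ (d + 1))\<^sup>2 * (M + 1) ^ D + 2 \<le> (2 ^ (d + 1))\<^sup>2 * ((N * e + 1) * (t + 1)) ^ D + 2 * (t + 1) ^ D"
    by (intro add_mono mult_mono power_mono) (auto simp: M_def algebra_simps)
  also have "\<dots> = K1 * (t + 1) ^ D" unfolding K1_def power_mult_distrib by (simp only: add_mult_distrib mult.assoc)
  also have "\<dots> \<le> (t + 1) ^ Suc D" unfolding power_Suc by (rule mult_le_mono1) (use t in simp)
  also have "\<dots> \<le> (t + 1) ^ e" using assms(3) by (intro power_increasing) auto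
  finally have 1: "(2 ^ (d + 1))\<^sup>2 * (M + 1) ^ D + 2 \<le> (t + 1) ^ e" .
  have "(M + 1) * ((e * t + 1)\<^sup>2 * (t + 1) ^ e * c)\<^sup>2 + C
      \<le> (2 * M) * ((2 * M)\<^sup>2 * (2 * M) ^ e * c)\<^sup>2 + C * M ^ (2 * e + 5)"
    using M Me t by (intro add_mono mult_mono power_mono) auto
  also have "(2 * M) * ((2 * M)\<^sup>2 * (2 * M) ^ e * c)\<^sup>2 = (2 * M) ^ (2 * e + 5) * c\<^sup>2"
    by (simp add: power_mult_distrib power2_eq_square numeral_eq_Suc power_add mult_2 algebra_simps)
  also have "\<dots> + C * M ^ (2 * e + 5) = (2 ^ (2 * e + 5) * c\<^sup>2 + C) * M ^ (2 * e + 5)"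
    by (simp add: power_mult_distrib algebra_simps)
  finally have "2 * ((M + 1) * ((e * t + 1)\<^sup>2 * (t + 1) ^ e * c)\<^sup>2 + C)
      \<le> 2 * ((2 ^ (2 * e + 5) * c\<^sup>2 + C) * M ^ (2 * e + 5))"
    by (rule mult_le_mono2)
  also have "\<dots> = K2 * M ^ (2 * e + 5)" by (simp only: K2_def mult.assoc)
  also have "\<dots> \<le> \<omega> M" using M t by (intro n0) simp
  finally show ?thesis using 1 M Me t e assms(2)
    by (intro exI[of _ t]) (auto simp: Let_def M_def[symmetric] c_def C_def, auto simp: M_def)
qed

section \<open>Stages of the construction\<close>

type_synonym 'k stage =
  "nat \<times> (bool \<Rightarrow> bool list \<Rightarrow> 'k) \<times> (bool \<Rightarrow> (bool list \<Rightarrow>\<^sub>0 'k)) \<times> nat"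

text \<open>At least \<open>2 ^ (k + 2)\<close> bounds the number of words of length at most
  \<open>k + 1\<close>, the degree treated at step \<open>k\<close>; so \<open>e\<close> exceeds the
  degree of the number of conditions.\<close>

fun stage_ok :: "(nat \<Rightarrow> nat) \<Rightarrow> nat \<Rightarrow> 'k::field stage \<Rightarrow> bool" where
  "stage_ok f k (N, g, r, e) \<longleftrightarrow> level N g r \<and> e > 2 ^ (k + 2) \<and> f (N * e + 1) \<le> 2 ^ e"

text \<open>The factor 2 pays for the two components of the Lie algebra. The last clause makes
  elements killed by \<open>\<Lambda>\<close> too long to be seen by the products kept at earlier
  levels.\<close>

fun stage_step :: "(nat \<Rightarrow> nat) \<Rightarrow> nat \<Rightarrow> 'k::field stage \<Rightarrow> 'k stage \<Rightarrow> bool" where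
  "stage_step \<omega> k (N, g, r, e) (M, g', r', e') \<longleftrightarrow> N * e \<le> M \<and>
    (\<forall>a. annihilates N g a \<longrightarrow> annihilates M g' a) \<and>
    (\<forall>a s. keys a \<subseteq> {w. 1 \<le> length w \<and> length w \<le> k + 1} \<and> s \<ge> 2 * M \<longrightarrow> annihilates M g' (a ^ s)) \<and>
    (\<exists>\<Lambda>. finite \<Lambda> \<and> 2 * card \<Lambda> \<le> \<omega> M \<and>
      (\<forall>a. (\<forall>w\<in>keys a. length w \<le> M) \<and> (\<forall>l\<in>\<Lambda>. pairing l a = 0) \<longrightarrow>
         annihilates M g' a \<and> (\<forall>w\<in>keys a. length w > N * e)))"

lemma stage_initial:
  assumes "subexponential f"
  shows "\<exists>x :: 'k::field stage. stage_ok f 0 x"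
proof -
  obtain e where e: "e > 2 ^ (0 + 2)" "f (1 * e + 1) \<le> 2 ^ e"
    using subexponential_le_power2[OF assms, of 1] by auto
  have "level 1 (\<lambda>b w. if w = [b] then 1 else 0 :: 'k) (\<lambda>b. single [b] 1)"
    by standard (auto split: if_splits)
  with e show ?thesis
    by (intro exI[of _ "(1, \<lambda>b w. if w = [b] then 1 else 0, \<lambda>b. single [b] 1, e)"]) simp
qed

lemma stage_next:
  fixes x :: "'k::field stage"
  assumes "subexponential f" and "super_polynomial \<omega>" and "stage_ok f k x"
  shows "\<exists>y. stage_ok f (Suc k) y \<and> stage_step \<omega> k x y"
proof -
  obtain N g r e where x: "x = (N, g, r, e)" by (cases x)
  interpret level N g r using assms(3) by (simp add: x)
  have e: "e > 2 ^ (k + 2)" using assms(3) by (simp add: x)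
  let ?X = "{w :: bool list. 1 \<le> length w \<and> length w \<le> k + 1}"
  have "card ?X \<le> card {w :: bool list. length w \<le> k + 1}"
    by (rule card_mono[OF bool_lists_length_le(1)]) auto
  also have "\<dots> < e" using bool_lists_length_le(2)[of "k + 1"] e by simp
  finally have D: "e > card ?X" .
  obtain t where t: "e * t > 0" "N * e \<le> N * (e * t)" "k + 1 \<le> N * (e * t)"
    "(2 ^ (k + 1 + 1))\<^sup>2 * (N * (e * t) + 1) ^ card ?X + 2 \<le> (t + 1) ^ e"
    "2 * ((N * (e * t) + 1) * ((e * t + 1)\<^sup>2 * (t + 1) ^ e * (2 ^ (N + 1))\<^sup>2)\<^sup>2 + 2 ^ (N * e + 1)) \<le> \<omega> (N * (e * t))"
    using parameter_exists[OF assms(2) N_pos D, of "k + 1"] unfolding Let_def by blast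
  define M where "M = N * (e * t)"
  obtain g' r' \<Lambda> where lev: "level M g' r'" and mono: "\<And>a. annihilates N g a \<Longrightarrow> annihilates M g' a"
    and nilp: "\<And>a s. keys a \<subseteq> ?X \<Longrightarrow> s \<ge> 2 * M \<Longrightarrow> annihilates M g' (a ^ s)"
    and \<Lambda>: "finite \<Lambda>" "card \<Lambda> \<le> (M + 1) * ((e * t + 1)\<^sup>2 * (t + 1) ^ e * (2 ^ (N + 1))\<^sup>2)\<^sup>2"
    and kill: "\<And>a. \<forall>w\<in>keys a. length w \<le> M \<Longrightarrow> \<forall>l\<in>\<Lambda>. pairing l a = 0 \<Longrightarrow> annihilates M g' a"
    using next_level[OF t(1,3,4)] unfolding M_def by blast
  obtain e' where e': "e' > 2 ^ (Suc k + 2)" "f (M * e' + 1) \<le> 2 ^ e'"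
    using subexponential_le_power2[OF assms(1) level.N_pos[OF lev]] by blast
  let ?W = "{w :: bool list. length w \<le> N * e}"
  \<comment> \<open>Coordinate functionals of the short words; an element killed by them has only
    words longer than \<open>N * e\<close>.\<close>
  define \<Delta> :: "(bool list \<Rightarrow> 'k) set" where "\<Delta> = (\<lambda>w x. if x = w then 1 else 0) ` ?W"
  have \<Delta>: "finite \<Delta>" "card \<Delta> \<le> 2 ^ (N * e + 1)"
    using bool_lists_length_le[of "N * e"] card_image_le[of ?W] by (auto simp: \<Delta>_def intro: le_trans)
  have short: "length w > N * e" if "\<forall>l\<in>\<Delta>. pairing l a = 0" "w \<in> keys a" for a w
  proof (rule ccontr)
    assume "\<not> ?thesis"
    then have "(\<lambda>x. if x = w then 1 else 0) \<in> \<Delta>" by (auto simp: \<Delta>_def)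
    with that(1) have "pairing (\<lambda>x. if x = w then 1 else 0) a = 0" by blast
    moreover have "pairing (\<lambda>x. if x = w then 1 else 0) a = lookup a w"
      using that(2) by (simp add: pairing_def if_distrib[of "\<lambda>x. _ * x"] cong: if_cong)
    ultimately show False using that(2) by (simp add: in_keys_iff)
  qed
  have "2 * card (\<Lambda> \<union> \<Delta>) \<le> 2 * (card \<Lambda> + card \<Delta>)"
    by (intro mult_le_mono2 card_Un_le)
  also have "\<dots> \<le> 2 * ((M + 1) * ((e * t + 1)\<^sup>2 * (t + 1) ^ e * (2 ^ (N + 1))\<^sup>2)\<^sup>2 + 2 ^ (N * e + 1))"
    by (intro mult_le_mono2 add_mono \<Lambda>(2) \<Delta>(2))
  also have "\<dots> \<le> \<omega> M" using t(5) unfolding M_def .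
  finally have card: "2 * card (\<Lambda> \<union> \<Delta>) \<le> \<omega> M" .
  have "\<exists>\<Lambda>. finite \<Lambda> \<and> 2 * card \<Lambda> \<le> \<omega> M \<and>
      (\<forall>a. (\<forall>w\<in>keys a. length w \<le> M) \<and> (\<forall>l\<in>\<Lambda>. pairing l a = 0) \<longrightarrow>
         annihilates M g' a \<and> (\<forall>w\<in>keys a. length w > N * e))"
    using card \<Lambda>(1) \<Delta>(1) kill short by (intro exI[of _ "\<Lambda> \<union> \<Delta>"]) blast
  then have "stage_step \<omega> k (N, g, r, e) (M, g', r', e')"
    using t(2) mono nilp by (simp add: M_def)
  with lev e' show ?thesis
    by (intro exI[of _ "(M, g', r', e')"]) (simp add: x)
qed

section \<open>The ideal and its codimension\<close>

definition codim_le :: "(bool list \<Rightarrow>\<^sub>0 'k::field) set \<Rightarrow> nat \<Rightarrow> nat \<Rightarrow> bool" where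
  "codim_le E n d \<longleftrightarrow> (\<exists>\<Lambda>. finite \<Lambda> \<and> card \<Lambda> \<le> d \<and>
     (\<forall>a. (\<forall>w\<in>keys a. length w \<le> n) \<and> (\<forall>l\<in>\<Lambda>. pairing l a = 0) \<longrightarrow> a \<in> E))"

text \<open>Independence modulo \<open>E\<close> witnessed by dual functionals. The elements are
  homogeneous so that each lands in a single Lie power.\<close>

definition codim_ge :: "(bool list \<Rightarrow>\<^sub>0 'k::field) set \<Rightarrow> nat \<Rightarrow> nat \<Rightarrow> bool" where
  "codim_ge E n d \<longleftrightarrow> (\<exists>(B :: bool list set) h x. finite B \<and> d \<le> card B \<and>
     (\<forall>\<beta>\<in>B. \<forall>w\<in>keys (x \<beta>). length w = n) \<and> (\<forall>\<beta>\<in>B. \<forall>a\<in>E. pairing (h \<beta>) a = 0) \<and>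
     (\<forall>\<beta>\<in>B. \<forall>\<beta>'\<in>B. pairing (h \<beta>) (x \<beta>') = (if \<beta> = \<beta>' then 1 else 0)))"

locale nil_ideal =
  fixes E :: "(bool list \<Rightarrow>\<^sub>0 'k::field) set"
  assumes E_0: "0 \<in> E" and E_add: "a \<in> E \<Longrightarrow> b \<in> E \<Longrightarrow> a + b \<in> E"
    and E_left: "a \<in> E \<Longrightarrow> b * a \<in> E" and E_right: "a \<in> E \<Longrightarrow> a * b \<in> E"
    and E_nil: "[] \<notin> keys a \<Longrightarrow> \<exists>s. a ^ s \<in> E"

lemma oscillating_nil_ideal:
  assumes "subexponential f" and "super_polynomial \<omega>"
  shows "\<exists>E :: (bool list \<Rightarrow>\<^sub>0 'k::field) set. nil_ideal E \<and>
    (\<exists>\<^sub>\<infinity>n. \<exists>d. 2 * d \<le> \<omega> n \<and> codim_le E n d) \<and> (\<exists>\<^sub>\<infinity>n. codim_ge E n (f (n + 1)))"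
proof -
  obtain st :: "nat \<Rightarrow> 'k stage" where st: "\<And>k. stage_ok f k (st k)" "\<And>k. stage_step \<omega> k (st k) (st (Suc k))"
    using dependent_nat_choice[of "stage_ok f" "stage_step \<omega>"] stage_initial[OF assms(1)]
      stage_next[OF assms] by metis
  define N where "N k = fst (st k)" for k
  define g where "g k = fst (snd (st k))" for k
  define r where "r k = fst (snd (snd (st k)))" for k
  define e where "e k = snd (snd (snd (st k)))" for k
  have st_eq: "st k = (N k, g k, r k, e k)" for k
    by (simp add: N_def g_def r_def e_def)
  have lev: "level (N k) (g k) (r k)" and e: "e k > 2 ^ (k + 2)" and fe: "f (N k * e k + 1) \<le> 2 ^ e k" for k
    using st(1)[of k] by (auto simp: st_eq)
  have Ne: "N k * e k \<le> N (Suc k)" and step: "annihilates (N k) (g k) a \<Longrightarrow> annihilates (N (Suc k)) (g (Suc k)) a"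
    and nilp: "keys b \<subseteq> {w. 1 \<le> length w \<and> length w \<le> k + 1} \<Longrightarrow> s \<ge> 2 * N (Suc k) \<Longrightarrow>
      annihilates (N (Suc k)) (g (Suc k)) (b ^ s)"
    and bound: "\<exists>\<Lambda>. finite \<Lambda> \<and> 2 * card \<Lambda> \<le> \<omega> (N (Suc k)) \<and>
      (\<forall>a. (\<forall>w\<in>keys a. length w \<le> N (Suc k)) \<and> (\<forall>l\<in>\<Lambda>. pairing l a = 0) \<longrightarrow>
         annihilates (N (Suc k)) (g (Suc k)) a \<and> (\<forall>w\<in>keys a. length w > N k * e k))" for k a b s
    using st(2)[of k] by (auto simp: st_eq)
  have N_pos: "N k > 0" for k using level.N_pos[OF lev] .
  have e1: "e k > 1" for k using e[of k] by (meson le_less_trans one_le_numeral one_le_power)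
  have smono: "strict_mono N"
  proof (rule strict_mono_Suc_iff[THEN iffD2], rule allI)
    fix k
    have "N k < N k * e k" using N_pos[of k] e1[of k] by simp
    with Ne[of k] show "N k < N (Suc k)" by linarith
  qed
  have Ne_le: "N j * e j \<le> N k * e k" if "j \<le> k" for j k
  proof (cases "j = k")
    case False
    then have "N (Suc j) \<le> N k" using that smono by (simp add: strict_mono_less_eq)
    moreover have "N k \<le> N k * e k" using e1[of k] by simp
    ultimately show ?thesis using Ne[of j] by linarith
  qed simp
  have chain: "annihilates (N j) (g j) a" if "annihilates (N k) (g k) a" "k \<le> j" for j k a
    using that(2,1) by (induction rule: dec_induct) (auto intro: step)
  \<comment> \<open>Level \<open>k\<close> contributes only products of exactly \<open>e k\<close>
    blocks: enough for the lower bound at \<open>N k * e k\<close>, but invisible to longer words,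
    which allows slow growth at \<open>N (Suc k)\<close>.\<close>
  define E where "E = {a. \<forall>k \<beta> u v. length \<beta> = e k \<longrightarrow> pairing (\<lambda>w. block_prod (N k) (g k) \<beta> (u @ w @ v)) a = 0}"
  \<comment> \<open>Levels up to \<open>k\<close> vanish on words containing one longer than
    \<open>N k * e k\<close>; later levels inherit the annihilation.\<close>
  have in_E: "a \<in> E" if ann: "annihilates (N (Suc k)) (g (Suc k)) a" and long: "\<And>w. w \<in> keys a \<Longrightarrow> length w > N k * e k" for a k
    unfolding E_def
  proof clarify
    fix j and \<beta> u v :: "bool list" assume \<beta>: "length \<beta> = e j"
    show "pairing (\<lambda>w. block_prod (N j) (g j) \<beta> (u @ w @ v)) a = 0"
    proof (cases "j \<le> k")
      case True
      show ?thesis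
      proof (rule pairing_eq_0, rule ccontr)
        fix w assume "w \<in> keys a" "block_prod (N j) (g j) \<beta> (u @ w @ v) \<noteq> 0"
        with level.block_prod_length[OF lev] long \<beta> have "length (u @ w @ v) = N j * e j" "length w > N k * e k"
          by metis+
        with Ne_le[OF True] show False by simp
      qed
    next
      case False
      with chain[OF ann, of j] show ?thesis by (simp add: annihilates_def)
    qed
  qed
  have "nil_ideal E"
  proof
    show "0 \<in> E" by (simp add: E_def)
    show "a + b \<in> E" if "a \<in> E" "b \<in> E" for a b using that by (simp add: E_def pairing_add)
    show "b * a \<in> E" if a: "a \<in> E" for a b
      unfolding E_def
    proof clarify
      fix k and \<beta> u v :: "bool list" assume "length \<beta> = e k"
      then have "pairing (\<lambda>z. block_prod (N k) (g k) \<beta> ((u @ w) @ z @ v)) a = 0" for w using a unfolding E_def by blast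
      then show "pairing (\<lambda>w. block_prod (N k) (g k) \<beta> (u @ w @ v)) (b * a) = 0"
        by (simp add: pairing_mult_list)
    qed
    show "a * b \<in> E" if a: "a \<in> E" for a b
      unfolding E_def
    proof clarify
      fix k and \<beta> u v :: "bool list" assume "length \<beta> = e k"
      then have "pairing (\<lambda>z. block_prod (N k) (g k) \<beta> (u @ z @ (w @ v))) a = 0" for w using a unfolding E_def by blast
      then show "pairing (\<lambda>w. block_prod (N k) (g k) \<beta> (u @ w @ v)) (a * b) = 0"
        unfolding pairing_mult_list by (subst pairing_swap) simp
    qed
    show "\<exists>s. a ^ s \<in> E" if "[] \<notin> keys a" for a
    proof -
      \<comment> \<open>Any bound for the lengths of the words in \<open>a\<close> will do; it
        selects the step that made powers of \<open>a\<close> vanish.\<close>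
      define k where "k = (\<Sum>w\<in>keys a. length w)"
      have pos: "1 \<le> length w" if "w \<in> keys a" for w
        using \<open>[] \<notin> keys a\<close> that by (cases w) auto
      have "length w \<le> k" if "w \<in> keys a" for w
        unfolding k_def using that by (intro member_le_sum) auto
      then have sub: "keys a \<subseteq> {w. 1 \<le> length w \<and> length w \<le> k + 1}" using pos by fastforce
      have "a ^ (2 * N (Suc k)) \<in> E"
      proof (rule in_E)
        show "annihilates (N (Suc k)) (g (Suc k)) (a ^ (2 * N (Suc k)))" by (rule nilp[OF sub order_refl])
        show "length w > N k * e k" if "w \<in> keys (a ^ (2 * N (Suc k)))" for w
          using length_keys_power[OF pos that] Ne[of k] N_pos[of "Suc k"] by linarith
      qed
      then show ?thesis ..
    qed
  qed
  moreover have "\<exists>\<^sub>\<infinity>n. \<exists>d. 2 * d \<le> \<omega> n \<and> codim_le E n d"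
      unfolding INFM_nat
    proof
      fix m
      have "N (Suc m) > m" using seq_suble[OF smono, of "Suc m"] by simp
      moreover have "\<exists>d. 2 * d \<le> \<omega> (N (Suc m)) \<and> codim_le E (N (Suc m)) d"
        using bound[of m] in_E unfolding codim_le_def by (meson order_refl)
      ultimately show "\<exists>n>m. \<exists>d. 2 * d \<le> \<omega> n \<and> codim_le E n d" by blast
    qed
  moreover have "\<exists>\<^sub>\<infinity>n. codim_ge E n (f (n + 1))"
      unfolding INFM_nat
    proof
      fix m
      interpret level "N m" "g m" "r m" by (rule lev)
      let ?B = "{\<beta> :: bool list. length \<beta> = e m}"
      have B: "finite ?B" "card ?B = 2 ^ e m"
        using card_lists_length_eq[of "UNIV :: bool set"] finite_lists_length_eq[of "UNIV :: bool set"] by auto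
      have "m < N m * e m"
        using seq_suble[OF smono, of m] N_pos e1[of m] by (metis le_less_trans less_le_trans mult.right_neutral mult_less_cancel1 nat_less_le)
      moreover have "\<forall>\<beta>\<in>?B. \<forall>a\<in>E. pairing (block_prod (N m) (g m) \<beta>) a = 0"
      proof clarify
        fix \<beta> :: "bool list" and a assume "a \<in> E" "length \<beta> = e m"
        then have "pairing (\<lambda>w. block_prod (N m) (g m) \<beta> ([] @ w @ [])) a = 0" unfolding E_def by blast
        then show "pairing (block_prod (N m) (g m) \<beta>) a = 0" by simp
      qed
      ultimately show "\<exists>n>m. codim_ge E n (f (n + 1))"
        unfolding codim_ge_def using B fe[of m] keys_dual_prod pairing_block_prod_dual_prod
        by (intro exI[of _ "N m * e m"] conjI exI[of _ ?B] exI[of _ "block_prod (N m) (g m)"] exI[of _ dual_prod]) auto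
    qed
  ultimately show ?thesis by blast
qed

section \<open>The Lie algebra\<close>

type_synonym 'k free = "bool list \<Rightarrow>\<^sub>0 'k"

section \<open>The quotient inside a fixed vector space\<close>

definition push :: "('w \<Rightarrow> nat) \<Rightarrow> ('w \<Rightarrow>\<^sub>0 'k::field) \<Rightarrow> (nat \<Rightarrow>\<^sub>0 'k)" where
  "push \<phi> a = (\<Sum>w\<in>keys a. single (\<phi> w) (lookup a w))"

lemma lookup_push: "lookup (push \<phi> a) n = pairing (\<lambda>w. if \<phi> w = n then 1 else 0) a"
  by (simp add: push_def pairing_def lookup_sum lookup_single when_def if_distrib[of "\<lambda>x. _ * x"] cong: if_cong)

lemma push_add: "push \<phi> (a + b) = push \<phi> a + push \<phi> b"
  by (rule poly_mapping_eqI) (simp add: lookup_push lookup_add pairing_add)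

lemma push_smul: "push \<phi> (smul c a) = smul c (push \<phi> a)"
  by (rule poly_mapping_eqI) (simp add: lookup_push pairing_smul)

text \<open>Extend a basis of \<open>E\<close> to the whole space and let \<open>Q\<close> kill the
  former and fix the added vectors. Then \<open>a - Q a\<close> always lies in \<open>E\<close>, so
  \<open>Q\<close> chooses coset representatives.\<close>

lemma linear_map_with_kernel:
  fixes E :: "('w::monoid_add \<Rightarrow>\<^sub>0 'k::field) set"
  assumes "module.subspace smul E"
  obtains Q :: "('w \<Rightarrow>\<^sub>0 'k) \<Rightarrow> ('w \<Rightarrow>\<^sub>0 'k)" where
    "\<And>a b. Q (a + b) = Q a + Q b" "\<And>c a. Q (smul c a) = smul c (Q a)" "\<And>a. Q a = 0 \<longleftrightarrow> a \<in> E"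
proof -
  interpret vp: vector_space_pair "smul :: 'k \<Rightarrow> ('w \<Rightarrow>\<^sub>0 'k) \<Rightarrow> _" "smul :: 'k \<Rightarrow> ('w \<Rightarrow>\<^sub>0 'k) \<Rightarrow> _"
    by (simp add: vector_space_pair_def vector_space_smul)
  obtain B where B: "B \<subseteq> E" "vp.vs1.independent B" "E \<subseteq> vp.vs1.span B"
    using vp.vs1.maximal_independent_subset[of E] by blast
  define B' where "B' = vp.vs1.extend_basis B"
  have B': "B \<subseteq> B'" "vp.vs1.independent B'" "vp.vs1.span B' = UNIV"
    unfolding B'_def using B(2) vp.vs1.extend_basis_superset vp.vs1.independent_extend_basis
      vp.vs1.span_extend_basis by blast+
  define Q where "Q = vp.construct B' (\<lambda>b. if b \<in> B then 0 else b)"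
  have lin: "Vector_Spaces.linear smul smul Q"
    unfolding Q_def by (rule vp.linear_construct[OF B'(2)])
  have Qb: "Q b = (if b \<in> B then 0 else b)" if "b \<in> B'" for b
    unfolding Q_def using vp.construct_basis[OF B'(2) that] .
  have add: "Q (a + b) = Q a + Q b" for a b by (rule vp.linear_add[OF lin])
  have scl: "Q (smul c a) = smul c (Q a)" for c a by (rule vp.linear_scale[OF lin])
  have "a - Q a \<in> E" for a
  proof -
    have "a \<in> vp.vs1.span B'" using B'(3) by simp
    then show ?thesis
    proof (induction rule: vp.vs1.span_induct)
      show "vp.vs1.subspace {a. a - Q a \<in> E}"
      proof (rule vp.vs1.subspaceI)
        show "0 \<in> {a. a - Q a \<in> E}"
          using vp.linear_0[OF lin] vp.vs1.subspace_0[OF assms] by simp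
      next
        fix x y assume "x \<in> {a. a - Q a \<in> E}" "y \<in> {a. a - Q a \<in> E}"
        then have "(x - Q x) + (y - Q y) \<in> E" using vp.vs1.subspace_add[OF assms] by blast
        then show "x + y \<in> {a. a - Q a \<in> E}" by (simp add: add algebra_simps)
      next
        fix c x assume "x \<in> {a. a - Q a \<in> E}"
        then have "smul c (x - Q x) \<in> E" using vp.vs1.subspace_scale[OF assms] by blast
        then show "smul c x \<in> {a. a - Q a \<in> E}"
          by (simp add: scl vp.vs1.scale_right_diff_distrib)
      qed
      show "x - Q x \<in> E" if "x \<in> B'" for x
        using Qb[OF that] B(1) vp.vs1.subspace_0[OF assms] by auto
    qed
  qed
  moreover have "Q a = 0" if "a \<in> E" for a
    by (rule vp.linear_eq_0_on_span[OF lin, where b = B]) (use that B(3) B'(1) Qb in auto)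
  ultimately have "Q a = 0 \<longleftrightarrow> a \<in> E" for a by (metis diff_zero)
  with add scl that show thesis by blast
qed

text \<open>The bracket of the semidirect product of the free algebra and its left regular module.\<close>

fun pair_bracket :: "'k::field free \<times> 'k free \<Rightarrow> 'k free \<times> 'k free \<Rightarrow> 'k free \<times> 'k free" where
  "pair_bracket (a, m) (b, n) = (a * b - b * a, a * n - b * m)"

lemma keys_diff_free: "keys (p - q :: 'w \<Rightarrow>\<^sub>0 'k::field) \<subseteq> keys p \<union> keys q"
  by (auto simp: in_keys_iff lookup_minus)

lemma (in nil_ideal) subspace_E: "module.subspace smul E"
  by (rule module.subspaceI[OF module_iff_vector_space[THEN iffD2, OF vector_space_smul]])
    (simp_all add: E_0 E_add E_left smul_def)

text \<open>The range of \<open>P\<close> is a copy of the direct sum of two quotients by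
  \<open>E\<close>, the associative part and the regular module, inside the ambient space.\<close>

locale lie_quotient = nil_ideal E
  for E :: "'k::field free set" +
  fixes P :: "'k free \<times> 'k free \<Rightarrow> (nat \<Rightarrow>\<^sub>0 'k)"
  assumes P_add: "P (x + y) = P x + P y"
    and P_smul: "P (smul c a, smul c m) = smul c (P (a, m))"
    and P_eq_0_iff: "P (a, m) = 0 \<longleftrightarrow> a \<in> E \<and> m \<in> E"

lemma (in nil_ideal) lie_quotient_exists: "\<exists>P. lie_quotient E P"
proof -
  obtain Q :: "'k free \<Rightarrow> 'k free" where Q: "\<And>a b. Q (a + b) = Q a + Q b"
    "\<And>c a. Q (smul c a) = smul c (Q a)" "\<And>a. Q a = 0 \<longleftrightarrow> a \<in> E"
    using linear_map_with_kernel[OF subspace_E] by metis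
  define \<phi> where "\<phi> b w = to_nat (b :: bool, w :: bool list)" for b w
  define P where "P = (\<lambda>(a, m). push (\<phi> False) (Q a) + push (\<phi> True) (Q m))"
  have "lie_quotient E P"
  proof
    show "P (x + y) = P x + P y" for x y by (simp add: P_def Q push_add split: prod.split)
    show "P (smul c a, smul c m) = smul c (P (a, m))" for c a m
      unfolding P_def by (simp add: Q push_smul) (simp add: smul_def distrib_left)
    fix a m
    \<comment> \<open>The encoding of component and word is injective, so the two components do not
      interfere.\<close>
    have lookup_push': "lookup (push (\<phi> b) x) (\<phi> b' w) = (if b = b' then lookup x w else 0)" for b b' x w
      by (auto simp: lookup_push \<phi>_def pairing_def if_distrib[of "\<lambda>x. _ * x"] in_keys_iff cong: if_cong)
    have "Q a = 0 \<and> Q m = 0" if "P (a, m) = 0"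
    proof (intro conjI poly_mapping_eqI)
      fix w
      have "lookup (P (a, m)) (\<phi> False w) = lookup (Q a) w" "lookup (P (a, m)) (\<phi> True w) = lookup (Q m) w"
        by (simp_all add: P_def lookup_add lookup_push')
      with that show "lookup (Q a) w = lookup 0 w" "lookup (Q m) w = lookup 0 w" by simp_all
    qed
    moreover have "P (a, m) = 0" if "Q a = 0" "Q m = 0" using that by (simp add: P_def push_def)
    ultimately show "P (a, m) = 0 \<longleftrightarrow> a \<in> E \<and> m \<in> E" using Q(3) by blast
  qed
  then show ?thesis by (intro exI[of _ P])
qed

section \<open>The nil Lie algebra\<close>

context lie_quotient
begin

sublocale vs: vector_space "smul :: 'k \<Rightarrow> (nat \<Rightarrow>\<^sub>0 'k) \<Rightarrow> _"
  by (rule vector_space_smul)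

lemma E_diff: "a \<in> E \<Longrightarrow> b \<in> E \<Longrightarrow> a - b \<in> E"
  using E_add[of a "(-1) * b"] E_left[of b "-1"] by simp

lemma P_0 [simp]: "P 0 = 0"
  using P_eq_0_iff[of 0 0] E_0 by (simp add: zero_prod_def)

lemma P_uminus: "P (- x) = - P x"
  using P_add[of x "- x"] by (simp add: add_eq_0_iff)

lemma P_diff: "P (x - y) = P x - P y"
  using P_add[of x "- y"] by (simp add: P_uminus)

lemma P_sum: "P (sum f A) = (\<Sum>x\<in>A. P (f x))"
  by (induction A rule: infinite_finite_induct) (auto simp: P_add)

lemma P_eq_iff: "P (a, m) = P (b, n) \<longleftrightarrow> a - b \<in> E \<and> m - n \<in> E"
  using P_eq_0_iff[of "a - b" "m - n"] P_diff[of "(a, m)" "(b, n)"] by simp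

definition bracket :: "(nat \<Rightarrow>\<^sub>0 'k) \<Rightarrow> (nat \<Rightarrow>\<^sub>0 'k) \<Rightarrow> (nat \<Rightarrow>\<^sub>0 'k)" where
  "bracket x y = P (pair_bracket (inv P x) (inv P y))"

text \<open>Because \<open>E\<close> is a two-sided ideal, the bracket does not depend on the
  representatives picked by \<open>inv P\<close>.\<close>

lemma bracket_P: "bracket (P s) (P t) = P (pair_bracket s t)"
proof -
  have cong: "P (pair_bracket s t) = P (pair_bracket s' t')" if "P s = P s'" "P t = P t'" for s t s' t'
  proof -
    obtain a m b n a' m' b' n' where st: "s = (a, m)" "t = (b, n)" "s' = (a', m')" "t' = (b', n')"
      by (metis surj_pair)
    have e: "a - a' \<in> E" "m - m' \<in> E" "b - b' \<in> E" "n - n' \<in> E"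
      using that by (auto simp: st P_eq_iff)
    have prod: "x * y - x' * y' \<in> E" if "x - x' \<in> E" "y - y' \<in> E" for x y x' y'
    proof -
      have "x * y - x' * y' = (x - x') * y + x' * (y - y')" by (simp add: algebra_simps)
      with that show ?thesis by (simp add: E_add E_left E_right)
    qed
    have "(a * b - a' * b') - (b * a - b' * a') \<in> E" "(a * n - a' * n') - (b * m - b' * m') \<in> E"
      using e by (simp_all add: E_diff prod)
    then show ?thesis by (simp add: st P_eq_iff algebra_simps)
  qed
  show ?thesis unfolding bracket_def
    by (rule cong) (simp_all add: f_inv_into_f)
qed

text \<open>Subalgebras without reference to a carrier: \<open>L\<close> is generated as a hull
  before it is known to be a Lie algebra.\<close>

definition closed_subspace :: "(nat \<Rightarrow>\<^sub>0 'k) set \<Rightarrow> bool" where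
  "closed_subspace S \<longleftrightarrow> vs.subspace S \<and> (\<forall>x\<in>S. \<forall>y\<in>S. bracket x y \<in> S)"

definition gens :: "(nat \<Rightarrow>\<^sub>0 'k) set" where
  "gens = P ` {(single [False] 1, 0), (single [True] 1, 0), (0, 1)}"

definition V :: "(nat \<Rightarrow>\<^sub>0 'k) set" where "V = vs.span gens"

definition L :: "(nat \<Rightarrow>\<^sub>0 'k) set" where "L = closed_subspace hull gens"

lemma closed_subspace_L: "closed_subspace L"
  unfolding L_def
proof (rule hull_in)
  fix T assume "Ball T closed_subspace"
  then show "closed_subspace (\<Inter> T)"
    by (auto simp: closed_subspace_def intro!: vs.subspace_Inter)
qed

lemma subspace_P_image:
  assumes "(0, 0) \<in> H" and "\<And>x y. x \<in> H \<Longrightarrow> y \<in> H \<Longrightarrow> x + y \<in> H"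
    and "\<And>c a m. (a, m) \<in> H \<Longrightarrow> (smul c a, smul c m) \<in> H"
  shows "vs.subspace (P ` H)"
proof (rule vs.subspaceI)
  show "0 \<in> P ` H" using assms(1) P_0 by (metis imageI zero_prod_def)
  show "x + y \<in> P ` H" if "x \<in> P ` H" "y \<in> P ` H" for x y
    using that assms(2) by (auto simp flip: P_add)
  show "smul c x \<in> P ` H" if "x \<in> P ` H" for c x
    using that assms(3) by (auto simp flip: P_smul)
qed

text \<open>Generators have no constant term in the associative component, and brackets create none,
  so \<open>E_nil\<close> applies throughout \<open>L\<close>.\<close>

lemma L_subset: "L \<subseteq> P ` {(a, m). [] \<notin> keys a}"
  unfolding L_def
proof (rule hull_minimal)
  show "gens \<subseteq> P ` {(a, m). [] \<notin> keys a}" by (auto simp: gens_def)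
  show "closed_subspace (P ` {(a, m). [] \<notin> keys a})"
    unfolding closed_subspace_def
  proof
    show "vs.subspace (P ` {(a, m). [] \<notin> keys a})"
      by (rule subspace_P_image) (auto simp: in_keys_iff lookup_add)
    have "[] \<notin> keys (a * b - b * a)" if "[] \<notin> keys a" for a b :: "'k free"
      using keys_diff_free[of "a * b" "b * a"] that by (auto elim!: keys_mult_list)
    then show "\<forall>x\<in>P ` {(a, m). [] \<notin> keys a}. \<forall>y\<in>P ` {(a, m). [] \<notin> keys a}.
        bracket x y \<in> P ` {(a, m). [] \<notin> keys a}"
      by (auto simp: bracket_P)
  qed
qed

lemma V_subset_L: "V \<subseteq> L"
  unfolding V_def
  by (rule vs.span_minimal) (use closed_subspace_L in \<open>auto simp: L_def hull_subset closed_subspace_def\<close>)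

lemma L_range: "x \<in> L \<Longrightarrow> \<exists>a m. x = P (a, m)"
  using L_subset by blast

sublocale lie: lie_algebra smul L bracket
proof
  show "vs.subspace L" "\<And>x y. x \<in> L \<Longrightarrow> y \<in> L \<Longrightarrow> bracket x y \<in> L"
    using closed_subspace_L by (auto simp: closed_subspace_def)
  fix x y z assume "x \<in> L" "y \<in> L"
  then obtain a m b n where xy: "x = P (a, m)" "y = P (b, n)" using L_range by metis
  show "bracket (smul c x) y = smul c (bracket x y)" "bracket x (smul c y) = smul c (bracket x y)" for c
  proof -
    have "pair_bracket (smul c a, smul c m) (b, n) = (smul c (a * b - b * a), smul c (a * n - b * m))"
      "pair_bracket (a, m) (smul c b, smul c n) = (smul c (a * b - b * a), smul c (a * n - b * m))"
      by (simp_all add: smul_mult_left smul_mult_right) (simp_all add: smul_def algebra_simps)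
    then show "bracket (smul c x) y = smul c (bracket x y)" "bracket x (smul c y) = smul c (bracket x y)"
      by (simp_all add: xy bracket_P P_smul flip: P_smul)
  qed
  assume "z \<in> L"
  then obtain d p where z: "z = P (d, p)" using L_range by metis
  show "bracket (x + y) z = bracket x z + bracket y z" "bracket x (y + z) = bracket x y + bracket x z"
    by (simp_all add: xy z bracket_P flip: P_add) (simp_all add: algebra_simps)
  have "pair_bracket (a, m) (pair_bracket (b, n) (d, p)) + pair_bracket (b, n) (pair_bracket (d, p) (a, m)) + pair_bracket (d, p) (pair_bracket (a, m) (b, n)) = 0"
    by (simp add: algebra_simps zero_prod_def)
  then show "bracket x (bracket y z) + bracket y (bracket z x) + bracket z (bracket x y) = 0"
    by (simp add: xy z bracket_P flip: P_add del: pair_bracket.simps)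
next
  fix x assume "x \<in> L"
  then obtain a m where x: "x = P (a, m)" using L_range by metis
  have "pair_bracket (a, m) (a, m) = 0" by (simp add: zero_prod_def)
  then show "bracket x x = 0" by (simp add: x bracket_P del: pair_bracket.simps)
qed

lemma funpow_ad: "(lie.ad (P s) ^^ k) (P t) = P ((pair_bracket s ^^ k) t)"
  by (induction k) (auto simp: lie.ad_def bracket_P)

text \<open>First the associative component dies in at most \<open>2 s\<close> steps, because \<open>ad a\<close> is the
  difference of the commuting multiplications by \<open>a\<close>; then the module component, on which the
  bracket acts modulo \<open>E\<close> as multiplication by \<open>a\<close>, dies in \<open>s\<close> more steps.\<close>

lemma nil: "lie.nil"
  unfolding lie.nil_def
proof
  fix x assume "x \<in> L"
  then obtain a m where x: "x = P (a, m)" and "[] \<notin> keys a" using L_subset by blast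
  then obtain s where s: "a ^ s \<in> E" using E_nil by blast
  let ?D = "pair_bracket (a, m)"
  have high: "a ^ p \<in> E" if "p \<ge> s" for p
    using E_left[OF s, of "a ^ (p - s)"] that by (simp flip: power_add)
  \<comment> \<open>After \<open>k\<close> brackets, \<open>2 * s - k\<close> surrounding factors of
    \<open>a\<close> suffice. For \<open>k = 0\<close> one side carries at least \<open>s\<close> of
    them.\<close>
  have assoc: "\<forall>p q. p + q \<ge> n \<longrightarrow> a ^ p * fst ((?D ^^ k) t) * a ^ q \<in> E" if "n + k = 2 * s" for n k t
    using that
  proof (induction k arbitrary: n)
    case 0
    have "a ^ p * fst t * a ^ q \<in> E" if "p + q \<ge> n" for p q
    proof (cases "p \<ge> s")
      case True
      then show ?thesis by (simp add: high E_right)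
    next
      case False
      then have "q \<ge> s" using that 0 by simp
      then show ?thesis by (simp add: high E_left)
    qed
    then show ?case by simp
  next
    case (Suc k)
    obtain b n' where bn: "(?D ^^ k) t = (b, n')" by fastforce
    have IH: "a ^ p * b * a ^ q \<in> E" if "p + q \<ge> Suc n" for p q
      using Suc.IH[of "Suc n"] Suc.prems that by (simp add: bn)
    show ?case
    proof (intro allI impI)
      fix p q assume "p + q \<ge> n"
      then have "a ^ Suc p * b * a ^ q - a ^ p * b * a ^ Suc q \<in> E"
        by (intro E_diff IH) auto
      also have "a ^ Suc p * b * a ^ q - a ^ p * b * a ^ Suc q = a ^ p * (a * b - b * a) * a ^ q"
        unfolding power_Suc2[of a p] power_Suc[of a q] by (simp add: algebra_simps)
      finally show "a ^ p * fst ((?D ^^ Suc k) t) * a ^ q \<in> E" by (simp add: bn)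
    qed
  qed
  \<comment> \<open>The associative component remains in \<open>E\<close>, so each bracket
    multiplies the module component by \<open>a\<close> modulo \<open>E\<close>.\<close>
  have modul: "fst ((?D ^^ k) t) \<in> E \<and> (\<forall>p\<ge>n. a ^ p * snd ((?D ^^ k) t) \<in> E)"
    if "fst t \<in> E" "n + k = s" for n k t
    using that(2)
  proof (induction k arbitrary: n)
    case 0
    then show ?case using that(1) by (auto intro: E_right high)
  next
    case (Suc k)
    obtain b n' where bn: "(?D ^^ k) t = (b, n')" by fastforce
    have IH: "b \<in> E" "\<And>p. p \<ge> Suc n \<Longrightarrow> a ^ p * n' \<in> E"
      using Suc.IH[of "Suc n"] Suc.prems by (simp_all add: bn)
    have "a ^ p * (a * n' - b * m) \<in> E" if "p \<ge> n" for p
    proof -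
      have "a ^ Suc p * n' - a ^ p * (b * m) \<in> E"
        using that by (intro E_diff IH E_left E_right) auto
      then show ?thesis unfolding power_Suc2 by (simp add: algebra_simps)
    qed
    moreover have "a * b - b * a \<in> E" using IH(1) by (intro E_diff E_left E_right)
    ultimately show ?case by (simp add: bn)
  qed
  have "(lie.ad x ^^ (s + 2 * s)) y = 0" if "y \<in> L" for y
  proof -
    obtain t where t: "y = P t" using L_range \<open>y \<in> L\<close> by blast
    have "fst ((?D ^^ (2 * s)) t) \<in> E" using assoc[of 0 "2 * s" t, rule_format, of 0 0] by simp
    from modul[OF this, of 0 s]
    have "fst ((?D ^^ (s + 2 * s)) t) \<in> E" "snd ((?D ^^ (s + 2 * s)) t) \<in> E"
      unfolding funpow_add o_apply by (auto dest!: spec[of _ 0])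
    then have "P ((?D ^^ (s + 2 * s)) t) = 0" by (metis P_eq_0_iff prod.collapse)
    then show ?thesis by (simp add: x t funpow_ad)
  qed
  then show "\<exists>k. \<forall>y\<in>L. (lie.ad x ^^ k) y = 0" by blast
qed

lemma generates:
  assumes "gens \<subseteq> X" "X \<subseteq> L"
  shows "lie.generates X"
proof -
  have "lie.lie_subalgebra hull X = L"
  proof (rule hull_unique[OF assms(2)])
    show "lie.lie_subalgebra L"
      using closed_subspace_L by (auto simp: lie.lie_subalgebra_def closed_subspace_def)
    fix S assume "X \<subseteq> S" "lie.lie_subalgebra S"
    then have "gens \<subseteq> S" "closed_subspace S"
      using assms(1) by (auto simp: lie.lie_subalgebra_def closed_subspace_def)
    then show "L \<subseteq> S" unfolding L_def by (rule hull_minimal)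
  qed
  then show ?thesis using assms(2) by (simp add: lie.generates_def)
qed

lemma finitely_generated: "lie.finitely_generated"
proof -
  have "gens \<subseteq> L" unfolding L_def by (rule hull_subset)
  then have "lie.generates gens" by (intro generates) auto
  moreover have "finite gens" by (simp add: gens_def)
  ultimately show ?thesis unfolding lie.finitely_generated_def by blast
qed

lemma fin_dim_generating_subspace: "lie.fin_dim_generating_subspace V"
  unfolding lie.fin_dim_generating_subspace_def
proof (intro conjI exI[of _ gens])
  show "finite gens" by (simp add: gens_def)
  show "vs.subspace V" "vs.span gens = V" by (simp_all add: V_def)
  show "lie.generates V" using V_subset_L by (intro generates) (auto simp: V_def vs.span_base)
qed

end

section \<open>Growth of the Lie algebra\<close>

context lie_quotient begin

definition bounded_part :: "nat \<Rightarrow> (nat \<Rightarrow>\<^sub>0 'k) set" where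
  "bounded_part n = P ` {(a, m). (\<forall>w\<in>keys a. length w \<le> n) \<and> (\<forall>w\<in>keys m. length w \<le> n)}"

lemma keys_add_bound:
  fixes a b :: "'k free"
  assumes "\<forall>w\<in>keys a. length w \<le> n" "\<forall>w\<in>keys b. length w \<le> n"
  shows "\<forall>w\<in>keys (a + b). length w \<le> n"
  using assms Poly_Mapping.keys_add[of a b] by blast

lemma subspace_bounded_part: "vs.subspace (bounded_part n)"
  unfolding bounded_part_def
proof (rule subspace_P_image)
  let ?H = "{(a, m :: 'k free). (\<forall>w\<in>keys (a :: 'k free). length w \<le> n) \<and> (\<forall>w\<in>keys m. length w \<le> n)}"
  show "(0, 0) \<in> ?H" by simp
  fix x y assume "x \<in> ?H" "y \<in> ?H"
  moreover obtain a m b p where xy: "x = (a, m)" "y = (b, p)" by (cases x; cases y)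
  ultimately have "\<forall>w\<in>keys a. length w \<le> n" "\<forall>w\<in>keys m. length w \<le> n"
    "\<forall>w\<in>keys b. length w \<le> n" "\<forall>w\<in>keys p. length w \<le> n" by simp_all
  with keys_add_bound[of a n b] keys_add_bound[of m n p] have
    "\<forall>w\<in>keys (a + b). length w \<le> n" "\<forall>w\<in>keys (m + p). length w \<le> n" by blast+
  then show "x + y \<in> ?H" by (simp add: xy)
next
  fix c a m
  assume "(a, m) \<in> {(a, m :: 'k free). (\<forall>w\<in>keys (a :: 'k free). length w \<le> n) \<and> (\<forall>w\<in>keys m. length w \<le> n)}"
  then show "(smul c a, smul c m) \<in> {(a, m). (\<forall>w\<in>keys a. length w \<le> n) \<and> (\<forall>w\<in>keys m. length w \<le> n)}"
    by (simp add: in_keys_iff)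
qed

lemma bounded_part_mono: "m \<le> n \<Longrightarrow> bounded_part m \<subseteq> bounded_part n"
  unfolding bounded_part_def by (rule image_mono) auto

text \<open>Bracketing concatenates words, and the module unit is a generator carrying the empty
  word, so word length never exceeds monomial length.\<close>

lemma lie_monomial_bounded_part: "lie.lie_monomial V i x \<Longrightarrow> x \<in> bounded_part i"
proof (induction rule: lie.lie_monomial.induct)
  case (letter v)
  have "gens \<subseteq> bounded_part 1"
    by (auto simp: gens_def bounded_part_def zero_list_def simp flip: single_one)
  then have "V \<subseteq> bounded_part 1" unfolding V_def
    by (rule vs.span_minimal[OF _ subspace_bounded_part])
  with letter show ?case by blast
next
  case (bracket i x j y)
  then obtain a m b n where x: "x = P (a, m)" and y: "y = P (b, n)"
    and i: "\<forall>w\<in>keys a. length w \<le> i" "\<forall>w\<in>keys m. length w \<le> i"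
    and j: "\<forall>w\<in>keys b. length w \<le> j" "\<forall>w\<in>keys n. length w \<le> j"
    by (auto simp: bounded_part_def)
  have mult: "length w \<le> i + j" if "w \<in> keys (p * q)" "\<forall>w\<in>keys p. length w \<le> k" "\<forall>w\<in>keys q. length w \<le> l" "k + l = i + j"
    for p q :: "'k free" and w k l
    using that by (fastforce elim!: keys_mult_list)
  have "\<forall>w\<in>keys (a * b - b * a). length w \<le> i + j" "\<forall>w\<in>keys (a * n - b * m). length w \<le> i + j"
    using keys_diff_free[of "a * b" "b * a"] keys_diff_free[of "a * n" "b * m"]
      mult[OF _ i(1) j(1)] mult[OF _ j(1) i(1)] mult[OF _ i(1) j(2)] mult[OF _ j(1) i(2)]
    by (auto simp: add.commute)
  then show ?case by (auto simp: x y bracket_P bounded_part_def)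
qed

abbreviation filtration :: "nat \<Rightarrow> (nat \<Rightarrow>\<^sub>0 'k) set" where
  "filtration n \<equiv> \<Sum>i = 1..n. lie.lie_power V i"

lemma set_sum_subset:
  assumes "finite I" "vs.subspace U" "\<And>i. i \<in> I \<Longrightarrow> S i \<subseteq> U"
  shows "sum S I \<subseteq> U"
  using assms(1,3)
proof (induction I)
  case empty
  show ?case using vs.subspace_0[OF assms(2)] by simp
next
  case (insert i I)
  show ?case
  proof
    fix x assume "x \<in> sum S (insert i I)"
    then obtain y z where "x = y + z" "y \<in> S i" "z \<in> sum S I"
      using insert.hyps by (auto elim: set_plus_elim)
    moreover have "sum S I \<subseteq> U" using insert by simp
    moreover have "S i \<subseteq> U" using insert by simp
    ultimately show "x \<in> U" using vs.subspace_add[OF assms(2)] by blast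
  qed
qed

lemma zero_in_set_sum:
  fixes S :: "'i \<Rightarrow> 'b::comm_monoid_add set"
  assumes "finite I" "\<And>i. i \<in> I \<Longrightarrow> 0 \<in> S i"
  shows "0 \<in> sum S I"
  using assms
proof (induction I)
  case (insert i I)
  then show ?case using set_plus_intro[of 0 "S i" 0 "sum S I"] by simp
qed simp

lemma filtration_subset: "filtration n \<subseteq> bounded_part n"
proof (rule set_sum_subset[OF _ subspace_bounded_part])
  fix i assume "i \<in> {1..n}"
  then have "{x. lie.lie_monomial V i x} \<subseteq> bounded_part n"
    using lie_monomial_bounded_part bounded_part_mono[of i n] by fastforce
  then show "lie.lie_power V i \<subseteq> bounded_part n"
    unfolding lie.lie_power_def by (rule vs.span_minimal[OF _ subspace_bounded_part])
qed simp

lemma lie_power_subset_filtration: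
  assumes "n \<ge> 1"
  shows "lie.lie_power V n \<subseteq> filtration n"
proof
  fix x assume x: "x \<in> lie.lie_power V n"
  have "0 \<in> (\<Sum>i\<in>{1..n} - {n}. lie.lie_power V i)"
    by (rule zero_in_set_sum) (auto simp: lie.lie_power_def vs.span_zero)
  from set_plus_intro[OF x this] have "x \<in> lie.lie_power V n + (\<Sum>i\<in>{1..n} - {n}. lie.lie_power V i)"
    by simp
  also have "\<dots> = filtration n" using assms by (intro sum.remove[symmetric]) auto
  finally show "x \<in> filtration n" .
qed

text \<open>Bracketing with a letter prepends it to a word in the module component; the additional 1
  counts the unit at the end.\<close>

lemma lie_monomial_word: "lie.lie_monomial V (length w + 1) (P (0, single w 1))"
proof (induction w)
  case Nil
  have "P (0, single [] 1) \<in> V"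
    unfolding V_def by (rule vs.span_base) (auto simp: gens_def zero_list_def simp flip: single_one)
  from lie.lie_monomial.letter[OF this] show ?case by simp
next
  case (Cons b w)
  have "P (single [b] 1, 0) \<in> V"
    unfolding V_def by (rule vs.span_base) (cases b, auto simp: gens_def)
  from lie.lie_monomial.bracket[OF lie.lie_monomial.letter[OF this] Cons]
  show ?case by (simp add: bracket_P mult_single plus_list_def)
qed

lemma homogeneous_in_filtration:
  assumes "\<forall>w\<in>keys x. length w = n"
  shows "P (0, x) \<in> filtration (n + 1)"
proof -
  have "P (0, x) = P (0, \<Sum>w\<in>keys x. smul (lookup x w) (single w 1))"
    unfolding smul_single mult_1_right by (subst poly_mapping_eq_sum_single[of x]) (rule refl)
  also have "(0, \<Sum>w\<in>keys x. smul (lookup x w) (single w 1)) = (\<Sum>w\<in>keys x. (0, smul (lookup x w) (single w 1)))"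
    by (simp add: prod_eq_iff fst_sum snd_sum)
  also have "P \<dots> = (\<Sum>w\<in>keys x. smul (lookup x w) (P (0, single w 1)))"
    unfolding P_sum P_smul[symmetric] by (simp add: smul_def)
  also have "\<dots> \<in> lie.lie_power V (n + 1)"
    unfolding lie.lie_power_def
    by (intro vs.span_sum vs.span_scale vs.span_base) (use assms lie_monomial_word in fastforce)
  finally show ?thesis using lie_power_subset_filtration[of "n + 1"] by auto
qed

text \<open>More than \<open>2 * d\<close> independent elements would outnumber the conditions
  imposed by \<open>\<Lambda>\<close> on both components. Elimination then gives a nontrivial
  combination with both components in \<open>E\<close>, a linear relation.\<close>

lemma growth_le:
  assumes "codim_le E n d"
  shows "lie.growth V n \<le> 2 * d"
proof (rule ccontr)
  obtain \<Lambda> where \<Lambda>: "finite \<Lambda>" "card \<Lambda> \<le> d"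
    and kill: "\<And>a. \<forall>w\<in>keys a. length w \<le> n \<Longrightarrow> \<forall>l\<in>\<Lambda>. pairing l a = 0 \<Longrightarrow> a \<in> E"
    using assms unfolding codim_le_def by blast
  assume "\<not> ?thesis"
  moreover obtain B where B: "B \<subseteq> filtration n" "vs.independent B" "card B = vs.dim (filtration n)"
    using vs.basis_exists by metis
  ultimately have large: "2 * card \<Lambda> < card B" using \<Lambda>(2) by (simp add: lie.growth_def)
  then have fB: "finite B" by (metis card.infinite not_less_zero)
  have "\<exists>a m. b = P (a, m) \<and> (\<forall>w\<in>keys a. length w \<le> n) \<and> (\<forall>w\<in>keys m. length w \<le> n)" if "b \<in> B" for b
    using that B(1) filtration_subset[of n] unfolding bounded_part_def by blast
  then obtain a m where am: "\<And>b. b \<in> B \<Longrightarrow> b = P (a b, m b)"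
    "\<And>b. b \<in> B \<Longrightarrow> \<forall>w\<in>keys (a b). length w \<le> n" "\<And>b. b \<in> B \<Longrightarrow> \<forall>w\<in>keys (m b). length w \<le> n"
    by metis
  define R where "R = (\<lambda>l b. pairing l (a b)) ` \<Lambda> \<union> (\<lambda>l b. pairing l (m b)) ` \<Lambda>"
  have fR: "finite R" using \<Lambda>(1) by (simp add: R_def)
  have "card R \<le> card \<Lambda> + card \<Lambda>" unfolding R_def
    by (rule order_trans[OF card_Un_le add_mono]) (auto intro: card_image_le \<Lambda>(1))
  with large have cR: "card R < card B" by simp
  obtain I cf where I: "I \<subseteq> B" "card I \<le> card R"
    and cf: "\<And>i j. j \<in> B - I \<Longrightarrow> i \<in> B - I \<Longrightarrow> cf j i = (if i = j then 1 else 0)"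
    and R: "\<And>j \<rho>. j \<in> B - I \<Longrightarrow> \<rho> \<in> R \<Longrightarrow> (\<Sum>i\<in>B. cf j i * \<rho> i) = 0"
    using elimination[OF fR fB] by blast
  have "I \<noteq> B" using I(2) cR by auto
  with I(1) obtain j where j: "j \<in> B - I" by blast
  have vanish: "(\<Sum>b\<in>B. smul (cf j b) (c b)) \<in> E"
    if c: "\<And>b. b \<in> B \<Longrightarrow> \<forall>w\<in>keys (c b). length w \<le> n" and cR: "\<And>l. l \<in> \<Lambda> \<Longrightarrow> (\<lambda>b. pairing l (c b)) \<in> R" for c
  proof (rule kill)
    have "(\<Sum>b\<in>B. cf j b * lookup (c b) w) = 0" if "length w > n" for w
    proof (rule sum.neutral, rule ballI)
      fix b assume "b \<in> B"
      then have "w \<notin> keys (c b)" using c that by fastforce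
      then show "cf j b * lookup (c b) w = 0" by (simp add: in_keys_iff)
    qed
    then show "\<forall>w\<in>keys (\<Sum>b\<in>B. smul (cf j b) (c b)). length w \<le> n"
      by (auto simp: in_keys_iff lookup_sum) (meson not_le)
    show "\<forall>l\<in>\<Lambda>. pairing l (\<Sum>b\<in>B. smul (cf j b) (c b)) = 0"
      using R[OF j cR] by (simp add: pairing_sum pairing_smul)
  qed
  have "(\<Sum>b\<in>B. smul (cf j b) b) = (\<Sum>b\<in>B. P (smul (cf j b) (a b), smul (cf j b) (m b)))"
    by (intro sum.cong refl) (simp add: P_smul am(1)[symmetric])
  also have "\<dots> = P (\<Sum>b\<in>B. smul (cf j b) (a b), \<Sum>b\<in>B. smul (cf j b) (m b))"
    unfolding P_sum[symmetric] by (rule arg_cong[of _ _ P]) (simp add: prod_eq_iff fst_sum snd_sum)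
  also have "\<dots> = 0"
    unfolding P_eq_0_iff using am(2,3) by (intro conjI vanish) (auto simp: R_def)
  finally have "(\<Sum>b\<in>B. smul (cf j b) b) = 0" .
  moreover have "cf j j \<noteq> 0" using cf[OF j j] by simp
  ultimately have "vs.dependent B" using vs.dependent_finite[OF fB] j by blast
  with B(2) show False by blast
qed

text \<open>Guarantees that the dimension is the size of a finite basis; without finiteness the
  cardinality would be 0 and no lower bound could follow.\<close>

lemma filtration_finite_span: "\<exists>F. finite F \<and> filtration n \<subseteq> vs.span F"
proof -
  let ?W = "{w :: bool list. length w \<le> n}"
  let ?F = "(\<lambda>w. P (single w 1, 0)) ` ?W \<union> (\<lambda>w. P (0, single w 1)) ` ?W"
  have "bounded_part n \<subseteq> vs.span ?F"
  proof
    fix x assume "x \<in> bounded_part n"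
    then obtain a m where x: "x = P (a, m)" and am: "\<forall>w\<in>keys a. length w \<le> n" "\<forall>w\<in>keys m. length w \<le> n"
      by (auto simp: bounded_part_def)
    have "(a, m) = (\<Sum>w\<in>keys a. (smul (lookup a w) (single w 1), smul (lookup a w) 0)) +
        (\<Sum>w\<in>keys m. (smul (lookup m w) 0, smul (lookup m w) (single w 1)))"
      by (simp add: prod_eq_iff fst_sum snd_sum smul_single flip: poly_mapping_eq_sum_single)
         (simp add: smul_def)
    then have "x = (\<Sum>w\<in>keys a. smul (lookup a w) (P (single w 1, 0))) +
        (\<Sum>w\<in>keys m. smul (lookup m w) (P (0, single w 1)))"
      by (simp only: x P_add P_sum P_smul)
    also have "\<dots> \<in> vs.span ?F"
      using am by (intro vs.span_add vs.span_sum vs.span_scale vs.span_base) auto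
    finally show "x \<in> vs.span ?F" .
  qed
  then have "filtration n \<subseteq> vs.span ?F" using filtration_subset by blast
  moreover have "finite ?F" using bool_lists_length_le(1) by simp
  ultimately show ?thesis by blast
qed

text \<open>The dual functionals vanish on \<open>E\<close>, so they separate the images of the
  \<open>x \<beta>\<close> in the module component, which lie in Lie power
  \<open>n + 1\<close>.\<close>

lemma growth_ge:
  assumes "codim_ge E n d"
  shows "d \<le> lie.growth V (n + 1)"
proof -
  obtain B :: "bool list set" and h x where B: "finite B" "d \<le> card B"
    and x: "\<And>\<beta>. \<beta> \<in> B \<Longrightarrow> \<forall>w\<in>keys (x \<beta>). length w = n"
    and h: "\<And>\<beta> a. \<beta> \<in> B \<Longrightarrow> a \<in> E \<Longrightarrow> pairing (h \<beta>) a = 0"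
    and dual: "\<And>\<beta> \<beta>'. \<beta> \<in> B \<Longrightarrow> \<beta>' \<in> B \<Longrightarrow> pairing (h \<beta>) (x \<beta>') = (if \<beta> = \<beta>' then 1 else 0)"
    using assms unfolding codim_ge_def by blast
  let ?y = "\<lambda>\<beta>. P (0, x \<beta>)"
  have inj: "inj_on ?y B"
  proof (rule inj_onI, rule ccontr)
    fix \<beta> \<beta>' assume *: "\<beta> \<in> B" "\<beta>' \<in> B" "?y \<beta> = ?y \<beta>'" "\<beta> \<noteq> \<beta>'"
    then have "pairing (h \<beta>) (x \<beta> - x \<beta>') = 0" by (auto simp: P_eq_iff intro: h)
    with * show False by (simp add: pairing_diff dual)
  qed
  have ind: "vs.independent (?y ` B)"
    unfolding vs.dependent_finite[OF finite_imageI[OF B(1)]]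
  proof clarify
    fix u \<beta> assume u: "(\<Sum>v\<in>?y ` B. smul (u v) v) = 0" and \<beta>: "\<beta> \<in> B" "u (?y \<beta>) \<noteq> 0"
    have "0 = (\<Sum>\<gamma>\<in>B. smul (u (?y \<gamma>)) (?y \<gamma>))"
      using u by (simp add: sum.reindex[OF inj])
    also have "\<dots> = P (\<Sum>\<gamma>\<in>B. (smul (u (?y \<gamma>)) 0, smul (u (?y \<gamma>)) (x \<gamma>)))"
      by (simp only: P_sum P_smul)
    also have "(\<Sum>\<gamma>\<in>B. (smul (u (?y \<gamma>)) 0, smul (u (?y \<gamma>)) (x \<gamma>))) = (0, \<Sum>\<gamma>\<in>B. smul (u (?y \<gamma>)) (x \<gamma>))"
      by (simp add: prod_eq_iff fst_sum snd_sum) (simp add: smul_def)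
    finally have "P (0, \<Sum>\<gamma>\<in>B. smul (u (?y \<gamma>)) (x \<gamma>)) = 0" by (rule sym)
    then have "(\<Sum>\<gamma>\<in>B. smul (u (?y \<gamma>)) (x \<gamma>)) \<in> E" unfolding P_eq_0_iff ..
    from h[OF \<beta>(1) this] have "u (?y \<beta>) = 0"
      using B(1) \<beta>(1)
      by (simp add: pairing_sum pairing_smul dual if_distrib[of "\<lambda>x. _ * x"] cong: if_cong)
    with \<beta>(2) show False by simp
  qed
  have sub: "?y ` B \<subseteq> filtration (n + 1)"
    using homogeneous_in_filtration[OF x] by blast
  obtain F where F: "finite F" "filtration (n + 1) \<subseteq> vs.span F"
    using filtration_finite_span by blast
  obtain C where C: "C \<subseteq> filtration (n + 1)" "vs.independent C" "filtration (n + 1) \<subseteq> vs.span C"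
    "card C = vs.dim (filtration (n + 1))"
    using vs.basis_exists by metis
  have "finite C" using vs.independent_span_bound[OF F(1) C(2)] C(1) F(2) by blast
  then have "card (?y ` B) \<le> card C"
    using vs.independent_span_bound[OF _ ind, of C] sub C(3) by blast
  then show ?thesis using B(2) by (simp add: C(4) card_image[OF inj] lie.growth_def)
qed

end

theorem corollary1p2:
  fixes f \<omega> :: "nat \<Rightarrow> nat"
  assumes "subexponential f"
    and "\<omega> \<in> {1..} \<rightarrow> {1..}" and "mono_on {1..} \<omega>" and "super_polynomial \<omega>"
    and "uncountable (UNIV :: 'k::field set)" and "CHAR('k) \<noteq> 2"
  shows "\<exists>(scale :: 'k \<Rightarrow> (nat \<Rightarrow>\<^sub>0 'k) \<Rightarrow> (nat \<Rightarrow>\<^sub>0 'k)) L bracket V.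
     lie_algebra scale L bracket \<and>
     lie_algebra.finitely_generated scale L bracket \<and>
     lie_algebra.nil L bracket \<and>
     lie_algebra.fin_dim_generating_subspace scale L bracket V \<and>
     (\<exists>\<^sub>\<infinity>n. lie_algebra.growth scale bracket V n \<le> \<omega> n) \<and>
     (\<exists>\<^sub>\<infinity>n. lie_algebra.growth scale bracket V n \<ge> f n)"
proof -
  obtain E :: "'k free set" where "nil_ideal E"
    and small: "\<exists>\<^sub>\<infinity>n. \<exists>d. 2 * d \<le> \<omega> n \<and> codim_le E n d"
    and large: "\<exists>\<^sub>\<infinity>n. codim_ge E n (f (n + 1))"
    using oscillating_nil_ideal[OF assms(1,4), where 'k = 'k] by blast
  from nil_ideal.lie_quotient_exists[OF this(1)] obtain P where "lie_quotient E P" ..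
  then interpret lie_quotient E P .
  have "\<exists>\<^sub>\<infinity>n. lie.growth V n \<le> \<omega> n"
  proof (rule INFM_mono[OF small])
    fix n assume "\<exists>d. 2 * d \<le> \<omega> n \<and> codim_le E n d"
    then obtain d where "2 * d \<le> \<omega> n" "codim_le E n d" by blast
    with growth_le[of n d] show "lie.growth V n \<le> \<omega> n" by linarith
  qed
  moreover have "\<exists>\<^sub>\<infinity>n. lie.growth V n \<ge> f n"
    unfolding INFM_nat
  proof
    fix m
    \<comment> \<open>Word length \<open>n\<close> corresponds to monomial length
      \<open>n + 1\<close>, at which the value of \<open>f\<close> is taken.\<close>
    obtain n where "n > m" "codim_ge E n (f (n + 1))"
      using large unfolding INFM_nat by blast
    with growth_ge[of n] show "\<exists>n>m. lie.growth V n \<ge> f n"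
      by (intro exI[of _ "n + 1"]) simp
  qed
  ultimately show ?thesis
    by (intro exI[of _ smul] exI[of _ L] exI[of _ bracket] exI[of _ V] conjI lie.lie_algebra_axioms
        finitely_generated nil fin_dim_generating_subspace)
qed

end
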